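(* Let $(X,\cdot,1)$ be a multiplicative monoid with a summation system $\Sigma$ such that: (i) $\Sigma$ satisfies left reorderability; (ii) $\Sigma$ is surjective onto $X$; (iii) every singleton family whose sole member is $1$ is summable with sum $1$; (iv) there is an element $-1\in X$ such that $\Sigma(1,-1)=\Sigma()$. Then, with $+$ taken to be the induced addition of $\Sigma$ (and $0:=\Sigma()$, and $-x$ the additive inverse of $x$), $\Sigma$ satisfies all of the following properties: reindexing invariance, subfamilies remain summable, empty sum existence, zero means nothing, singletons sum simply, finite-totality, prefix associativity, insertive associativity, monoid merger, additive extension closure, addition functoriality, negation functoriality, ordinal reindexing invariance, initial summability, postfix associativity, ordinal insertive associativity, infinite distributivity, left multiple summability, and left reorderability. Moreover, the set $X$ is a ring under the induced addition and the given multiplication.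
   Context: $\mathbb N=\{0,1,2,\dots\}$; $\mathscr P(I)$ is the power set of $I$; $\mathrm{Ord}$ is the class of ordinals. A summation system on a set $X$ is a partial function $\Sigma\colon\bigcup_I X^I\to X$, the union running over all sets $I$ (in a fixed universe, if preferred). A family $\underline a=(a_i)_{i\in I}\in X^I$ is summable if $\underline a\in\mathrm{dom}(\Sigma)$; its sum is $\Sigma\underline a$. $()$ is the empty family, and $(x_0,\dots,x_{n-1})$ denotes the family indexed by $\{0,\dots,n-1\}$. The induced addition of $\Sigma$ is the (a priori partial) binary operation $x+y:=\Sigma(x,y)$. The core of $(a_i)_{i\in I}$ is its subfamily indexed by $\{i\in I: a_i\neq\Sigma()\}$ (the inequality is interpreted as vacuously true if $()$ is not summable); $\underline b$ is a core-extension of $\underline a$ if $\underline a$ is a subfamily of $\underline b$ and both have the same core. For $\psi\colon K\to\mathscr P(I)$, the dual map $\psi'\colon I\to\mathscr P(K)$ is $\psi'(i)=\{k\in K: i\in\psi(k)\}$. For $\underline a\in X^I$, $\ell\notin I$, $x\in X$, the family $\underline a\#_\ell x\in X^{I\cup\{\ell\}}$ has entry $x$ at $\ell$ and agrees with $\underline a$ on $I$. For $\underline a\in X^I$, $\underline b\in X^J$, the family $\underline a+\underline b\in X^{I\cup J}$ is the componentwise sum after extending both families to $I\cup J$ by zeros; $-\underline a=(-a_i)_{i\in I}$. Properties: - Reindexing invariance: if $\varphi\colon I'\to I$ is a bijection and $(a_i)_{i\in I}$ is summable, then $(a_{\varphi(i')})_{i'\in I'}$ is summable with the same sum. - Subfamilies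 remain summable: if $I'\subseteq I$ and $(a_i)_{i\in I}$ is summable, then $(a_i)_{i\in I'}$ is summable. - Empty sum existence: $()\in\mathrm{dom}(\Sigma)$. - Zero means nothing: if $\underline b$ is a core-extension of $\underline a$, then $\underline b$ is summable iff $\underline a$ is, and then $\Sigma\underline a=\Sigma\underline b$. - Singletons sum simply: every family indexed by a one-element set is summable, with sum its unique member. - Finite-totality: every family with a finite index set is summable. - Prefix associativity: if $(a_i)_{i\in\mathbb N}$ is summable, then so is $(a_{i+1})_{i\in\mathbb N}$ and $\Sigma(a_i)_{i\in\mathbb N}=a_0+\Sigma(a_{i+1})_{i\in\mathbb N}$. - Insertive associativity: if $(a_i)_{i\in I}$ is summable and $P$ is a partition of $I$, then $\Sigma(a_i)_{i\in I}=\Sigma\big(\Sigma(a_j)_{j\in J}\big)_{J\in P}$, every sum on the right existing. - Monoid merger: if $(a_i)_{i\in I}$ is summable and $\psi\colon K\to\mathscr P(I)$ is such that each $i\in I$ lies in $\psi(k)$ for a unique $k\in K$, then $\Sigma(a_i)_{i\in I}=\Sigma\big(\Sigma(a_i)_{i\in\psi(k)}\big)_{k\in K}$, all sums on the right being defined. - Additive extension closure: if $\underline a\in X^I$ is summable, $\ell\notin I$, $x\in X$, then $\underline a\#_\ell x$ is summable with sum $\Sigma\underline a+x$. - Addition functoriality: if $\underline a,\underline b$ are summable, then so is $\underline a+\underline b$, and $\Sigma[\underline a+\underline b]=\Sigma\underline a+\Sigma\underline b$. - Negation functoriality: if $\underline a$ is summable, then so is $-\underline a$, and $\Sigma[-\underline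 a]=-\Sigma\underline a$. - Ordinal reindexing invariance: if $I,I'\subseteq\mathrm{Ord}$ are sets, $\varphi\colon I'\to I$ is an order isomorphism, and $(a_i)_{i\in I}$ is summable, then $(a_{\varphi(i')})_{i'\in I'}$ is summable with the same sum. - Initial summability: if $I\subseteq\mathrm{Ord}$ is a set and $(a_i)_{i\in I}$ is summable, then each initial segment $(a_j)_{j\in I,\,j<\alpha}$ ($\alpha\in\mathrm{Ord}$) is summable. - Postfix associativity: if $I\subseteq\mathrm{Ord}$ is a set with a last element $m$ and $(a_i)_{i\in I}$ is summable, then $(a_i)_{i\in I\setminus\{m\}}$ is summable and $\Sigma(a_i)_{i\in I}=\Sigma(a_i)_{i\in I\setminus\{m\}}+a_m$. - Ordinal insertive associativity: if $I\subseteq\mathrm{Ord}$ is a set, $(a_i)_{i\in I}$ is summable, and $\{J_k\}_{k\in K}$ is a partition of $I$ into (nonempty) subintervals indexed by a transversal $K$ with $k\in J_k$ for each $k\in K$, then $\Sigma(a_i)_{i\in I}=\Sigma\big(\Sigma(a_i)_{i\in J_k}\big)_{k\in K}$, all sums on the right existing. - Infinite distributivity: if $(a_i)_{i\in I}$ and $(b_j)_{j\in J}$ are summable, then so is $(a_ib_j)_{(i,j)\in I\times J}$, and $[\Sigma(a_i)_{i\in I}][\Sigma(b_j)_{j\in J}]=\Sigma(a_ib_j)_{(i,j)\in I\times J}$. - Left multiple summability: if $(a_i)_{i\in I}$ is summable, then $(r_ia_i)_{i\in I}$ is summable for any choice of $r_i\in X$. - Left reorderability: if $(a_i)_{i\in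 I}\in X^I$ is summable, $(r_k)_{k\in K}\in X^K$ is an arbitrary family, and $\psi\colon K\to\mathscr P(I)$ is a map such that $(r_k)_{k\in\psi'(i)}$ is summable for each $i\in I$, then $\Sigma\big([\Sigma(r_k)_{k\in\psi'(i)}]\,a_i\big)_{i\in I}=\Sigma\big(r_k[\Sigma(a_i)_{i\in\psi(k)}]\big)_{k\in K}$, where all sums are defined. *)

theory Defs
  imports
    "HOL-Algebra.Ring"
    "HOL-Library.Disjoint_Sets"
    "HOL-Library.FuncSet"
    "HOL-Library.Countable_Set_Type"
begin

section \<open>Set-theoretic universes\<close>

text \<open>
  Index sets range over the sets of a fixed universe. An element \<open>x\<close> of the universe is a set,
  whose members are \<open>elts x\<close>; a collection of elements is \<^emph>\<open>small\<close> if it is one of those sets.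
  The axioms say that the universe satisfies extensionality and foundation and is closed under
  subsets, images, unions and pairing, and contains an infinite set. Every Grothendieck universe
  with an infinite member qualifies; closure under power sets is not required.
\<close>

class set_universe =
  fixes elts :: "'a \<Rightarrow> 'a set"
  assumes inj_elts: "inj elts"
    and wf_elts: "wf {(x, y). x \<in> elts y}"
    and small_subset_ax: "A \<in> range elts \<Longrightarrow> B \<subseteq> A \<Longrightarrow> B \<in> range elts"
    and small_image_ax: "A \<in> range elts \<Longrightarrow> f ` A \<in> range elts"
    and small_Union_ax: "A \<in> range elts \<Longrightarrow> (\<Union>x\<in>A. elts x) \<in> range elts"
    and small_pair_ax: "{x, y} \<in> range elts"
    and infinite_set_ax: "\<exists>A \<in> range elts. infinite A"

definition small :: "'v::set_universe set \<Rightarrow> bool" where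
  "small A \<longleftrightarrow> A \<in> range elts"

text \<open>The set with a given small collection of members; unspecified if \<open>A\<close> is not small.\<close>

definition vset :: "'v set \<Rightarrow> 'v::set_universe" where
  "vset A = inv_into UNIV elts A"

lemma elts_vset: "small A \<Longrightarrow> elts (vset A) = A"
  by (simp add: small_def vset_def f_inv_into_f)

lemma vset_elts: "vset (elts x) = x"
  by (simp add: vset_def inj_elts)

text \<open>Kuratowski pairs and von Neumann natural numbers.\<close>

definition vpair :: "'v \<Rightarrow> 'v \<Rightarrow> 'v::set_universe" where
  "vpair x y = vset {vset {x}, vset {x, y}}"

primrec vnat :: "nat \<Rightarrow> 'v::set_universe" where
  "vnat 0 = vset {}"
| "vnat (Suc n) = vset (insert (vnat n) (elts (vnat n)))"

text \<open>
  By foundation, the ordinals are the transitive sets all of whose members are transitive;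
  \<open>\<alpha> < \<beta>\<close> means \<open>\<alpha> \<in> elts \<beta>\<close>.
\<close>

definition is_ord :: "'v::set_universe \<Rightarrow> bool" where
  "is_ord \<alpha> \<longleftrightarrow> (\<forall>\<beta>\<in>elts \<alpha>. elts \<beta> \<subseteq> elts \<alpha>) \<and> (\<forall>\<beta>\<in>elts \<alpha>. \<forall>\<gamma>\<in>elts \<beta>. elts \<gamma> \<subseteq> elts \<beta>)"

text \<open>The hereditarily countable sets form such a universe.\<close>

datatype hc = HC (hc_cset: "hc cset")

instantiation hc :: set_universe
begin

definition elts_hc :: "hc \<Rightarrow> hc set" where
  "elts_hc x = rcset (hc_cset x)"

lemma range_elts_hc: "A \<in> range (elts :: hc \<Rightarrow> hc set) \<longleftrightarrow> countable A"
proof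
  show "A \<in> range elts \<Longrightarrow> countable A" for A :: "hc set"
    by (auto simp: elts_hc_def)
  show "countable A \<Longrightarrow> A \<in> range elts" for A :: "hc set"
    by (rule image_eqI[where x = "HC (acset A)"]) (simp_all add: elts_hc_def)
qed

instance
proof
  show "inj (elts :: hc \<Rightarrow> hc set)"
    by (intro injI) (simp add: elts_hc_def rcset_inject hc.expand)
  show "wf {(x :: hc, y). x \<in> elts y}"
  proof (rule wfUNIVI)
    fix P :: "hc \<Rightarrow> bool" and x
    assume *: "\<forall>x. (\<forall>y. (y, x) \<in> {(x, y). x \<in> elts y} \<longrightarrow> P y) \<longrightarrow> P x"
    show "P x"
    proof (induction x)
      case (HC c)
      then show ?case
        using * by (auto simp: elts_hc_def cin.rep_eq)
    qed
  qed
  have "infinite (UNIV :: hc set)"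
  proof
    assume fin: "finite (UNIV :: hc set)"
    then have "(UNIV :: hc set) \<in> range elts"
      unfolding range_elts_hc by (rule countable_finite)
    then obtain x :: hc where "elts x = UNIV" by auto
    then have "(x, x) \<in> {(x :: hc, y). x \<in> elts y}" by simp
    then show False
      using \<open>wf {(x :: hc, y). x \<in> elts y}\<close> by (meson wf_not_refl)
  qed
  then show "\<exists>A \<in> range (elts :: hc \<Rightarrow> hc set). infinite A"
    by (meson infinite_countable_subset' range_elts_hc)
qed (auto simp only: range_elts_hc countable_subset countable_image countable_insert
      countable_empty intro!: countable_UN, auto simp: elts_hc_def)

end

section \<open>Families and summation systems\<close>

text \<open>
  A family in \<open>X\<^sup>I\<close> is a partial map with domain \<open>I\<close> and values in \<open>X\<close>, so that subfamilies are
  restrictions \<open>a |` J\<close>, the empty family is \<open>Map.empty\<close>, and \<open>a #\<^sub>l x\<close> is \<open>a(l \<mapsto> x)\<close>.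
\<close>

definition families :: "'x set \<Rightarrow> ('v::set_universe \<rightharpoonup> 'x) set" where
  "families X = {a. small (dom a) \<and> ran a \<subseteq> X}"

definition fam :: "'v set \<Rightarrow> ('v \<Rightarrow> 'x) \<Rightarrow> ('v \<rightharpoonup> 'x)" where
  "fam I f = (\<lambda>i. if i \<in> I then Some (f i) else None)"

text \<open>
  The family with index set \<open>e ` T\<close> and entry \<open>f t\<close> at \<open>e t\<close>, for \<open>e\<close> injective on \<open>T\<close>. It serves
  to index by pairs, natural numbers and sets, through their codes in the universe.
\<close>

definition fam_by :: "('t \<Rightarrow> 'v) \<Rightarrow> 't set \<Rightarrow> ('t \<Rightarrow> 'x) \<Rightarrow> ('v \<rightharpoonup> 'x)" where
  "fam_by e T f = fam (e ` T) (\<lambda>i. f (inv_into T e i))"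

definition seq :: "(nat \<Rightarrow> 'x) \<Rightarrow> ('v::set_universe \<rightharpoonup> 'x)" where
  "seq f = fam_by vnat UNIV f"

definition pair_fam :: "'x \<Rightarrow> 'x \<Rightarrow> ('v::set_universe \<rightharpoonup> 'x)" where
  "pair_fam x y = [vnat 0 \<mapsto> x, vnat 1 \<mapsto> y]"

type_synonym ('v, 'x) summation = "('v \<rightharpoonup> 'x) \<rightharpoonup> 'x"

definition summation_system :: "'x set \<Rightarrow> ('v::set_universe, 'x) summation \<Rightarrow> bool" where
  "summation_system X S \<longleftrightarrow> dom S \<subseteq> families X \<and> ran S \<subseteq> X"

definition sumval :: "('v, 'x) summation \<Rightarrow> ('v \<rightharpoonup> 'x) \<Rightarrow> 'x" where
  "sumval S a = the (S a)"

text \<open>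
  The induced addition, a partial operation. In the properties below, equations \<open>S a = \<dots>\<close> are
  between values of option type, and the left-hand side is \<open>Some _\<close> by a preceding or
  accompanying \<open>a \<in> dom S\<close>; hence they also assert that the sum on the right exists.
\<close>

definition induced_add :: "('v::set_universe, 'x) summation \<Rightarrow> 'x \<Rightarrow> 'x \<rightharpoonup> 'x" where
  "induced_add S x y = S (pair_fam x y)"

definition induced_ring ::
    "('x, 'm) monoid_scheme \<Rightarrow> ('v::set_universe, 'x) summation \<Rightarrow> 'x ring" where
  "induced_ring M S =
     \<lparr>carrier = carrier M, mult = mult M, one = one M,
      zero = sumval S Map.empty, add = (\<lambda>x y. the (induced_add S x y))\<rparr>"

text \<open>If the empty family is not summable, then \<open>S Map.empty = None\<close> and the core is all of \<open>a\<close>.\<close>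

definition core :: "('v, 'x) summation \<Rightarrow> ('v \<rightharpoonup> 'x) \<Rightarrow> ('v \<rightharpoonup> 'x)" where
  "core S a = a |` {i \<in> dom a. a i \<noteq> S Map.empty}"

definition core_extension :: "('v, 'x) summation \<Rightarrow> ('v \<rightharpoonup> 'x) \<Rightarrow> ('v \<rightharpoonup> 'x) \<Rightarrow> bool" where
  "core_extension S a b \<longleftrightarrow> a \<subseteq>\<^sub>m b \<and> core S a = core S b"

definition dual_map :: "'v set \<Rightarrow> ('v \<Rightarrow> 'v set) \<Rightarrow> 'v \<Rightarrow> 'v set" where
  "dual_map K \<psi> i = {k \<in> K. i \<in> \<psi> k}"

text \<open>The value at \<open>i\<close> of the extension by zero.\<close>

definition entry0 :: "('v, 'x) summation \<Rightarrow> ('v \<rightharpoonup> 'x) \<Rightarrow> 'v \<Rightarrow> 'x" where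
  "entry0 S a i = (case a i of None \<Rightarrow> sumval S Map.empty | Some x \<Rightarrow> x)"

definition fam_add ::
    "('v::set_universe, 'x) summation \<Rightarrow> ('v \<rightharpoonup> 'x) \<Rightarrow> ('v \<rightharpoonup> 'x) \<Rightarrow> ('v \<rightharpoonup> 'x)" where
  "fam_add S a b =
     (\<lambda>i. if i \<in> dom a \<union> dom b then induced_add S (entry0 S a i) (entry0 S b i) else None)"

definition ord_iso :: "('v::set_universe \<Rightarrow> 'v) \<Rightarrow> 'v set \<Rightarrow> 'v set \<Rightarrow> bool" where
  "ord_iso \<phi> I' I \<longleftrightarrow> bij_betw \<phi> I' I \<and> (\<forall>i\<in>I'. \<forall>j\<in>I'. i \<in> elts j \<longleftrightarrow> \<phi> i \<in> elts (\<phi> j))"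

definition ord_subinterval :: "'v::set_universe set \<Rightarrow> 'v set \<Rightarrow> bool" where
  "ord_subinterval J I \<longleftrightarrow> J \<subseteq> I \<and> (\<forall>x\<in>J. \<forall>y\<in>J. \<forall>z\<in>I. x \<in> elts z \<and> z \<in> elts y \<longrightarrow> z \<in> J)"

section \<open>Properties of summation systems\<close>

definition reindexing_invariance :: "('v, 'x) summation \<Rightarrow> bool" where
  "reindexing_invariance S \<longleftrightarrow>
     (\<forall>a \<in> dom S. \<forall>I' \<phi>. bij_betw \<phi> I' (dom a) \<longrightarrow>
        (a \<circ> \<phi>) |` I' \<in> dom S \<and> S ((a \<circ> \<phi>) |` I') = S a)"

definition subfamilies_summable :: "('v, 'x) summation \<Rightarrow> bool" where
  "subfamilies_summable S \<longleftrightarrow> (\<forall>a \<in> dom S. \<forall>I' \<subseteq> dom a. a |` I' \<in> dom S)"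

definition empty_sum_existence :: "('v, 'x) summation \<Rightarrow> bool" where
  "empty_sum_existence S \<longleftrightarrow> Map.empty \<in> dom S"

definition zero_means_nothing :: "'x set \<Rightarrow> ('v::set_universe, 'x) summation \<Rightarrow> bool" where
  "zero_means_nothing X S \<longleftrightarrow>
     (\<forall>a \<in> families X. \<forall>b \<in> families X. core_extension S a b \<longrightarrow>
        (b \<in> dom S \<longleftrightarrow> a \<in> dom S) \<and> (a \<in> dom S \<longrightarrow> S a = S b))"

definition singletons_sum_simply :: "'x set \<Rightarrow> ('v, 'x) summation \<Rightarrow> bool" where
  "singletons_sum_simply X S \<longleftrightarrow> (\<forall>i. \<forall>x\<in>X. S [i \<mapsto> x] = Some x)"

definition finite_totality :: "'x set \<Rightarrow> ('v::set_universe, 'x) summation \<Rightarrow> bool" where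
  "finite_totality X S \<longleftrightarrow> (\<forall>a \<in> families X. finite (dom a) \<longrightarrow> a \<in> dom S)"

definition prefix_associativity :: "('v::set_universe, 'x) summation \<Rightarrow> bool" where
  "prefix_associativity S \<longleftrightarrow>
     (\<forall>f. seq f \<in> dom S \<longrightarrow>
        seq (\<lambda>i. f (Suc i)) \<in> dom S \<and>
        S (seq f) = induced_add S (f 0) (sumval S (seq (\<lambda>i. f (Suc i)))))"

definition insertive_associativity :: "('v::set_universe, 'x) summation \<Rightarrow> bool" where
  "insertive_associativity S \<longleftrightarrow>
     (\<forall>a \<in> dom S. \<forall>P. partition_on (dom a) P \<longrightarrow>
        (\<forall>J\<in>P. a |` J \<in> dom S) \<and>
        S a = S (fam_by vset P (\<lambda>J. sumval S (a |` J))))"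

definition monoid_merger :: "('v::set_universe, 'x) summation \<Rightarrow> bool" where
  "monoid_merger S \<longleftrightarrow>
     (\<forall>a \<in> dom S. \<forall>K \<psi>. small K \<longrightarrow> \<psi> \<in> K \<rightarrow> Pow (dom a) \<longrightarrow>
        (\<forall>i \<in> dom a. \<exists>!k. k \<in> K \<and> i \<in> \<psi> k) \<longrightarrow>
        (\<forall>k\<in>K. a |` \<psi> k \<in> dom S) \<and>
        S a = S (fam K (\<lambda>k. sumval S (a |` \<psi> k))))"

definition additive_extension_closure :: "'x set \<Rightarrow> ('v::set_universe, 'x) summation \<Rightarrow> bool" where
  "additive_extension_closure X S \<longleftrightarrow>
     (\<forall>a \<in> dom S. \<forall>l x. l \<notin> dom a \<longrightarrow> x \<in> X \<longrightarrow>
        a(l \<mapsto> x) \<in> dom S \<and> S (a(l \<mapsto> x)) = induced_add S (sumval S a) x)"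

definition addition_functoriality :: "('v::set_universe, 'x) summation \<Rightarrow> bool" where
  "addition_functoriality S \<longleftrightarrow>
     (\<forall>a \<in> dom S. \<forall>b \<in> dom S.
        dom (fam_add S a b) = dom a \<union> dom b \<and> fam_add S a b \<in> dom S \<and>
        S (fam_add S a b) = induced_add S (sumval S a) (sumval S b))"

definition negation_functoriality ::
    "('x, 'm) monoid_scheme \<Rightarrow> ('v::set_universe, 'x) summation \<Rightarrow> bool" where
  "negation_functoriality M S \<longleftrightarrow>
     (\<forall>a \<in> dom S.
        S (map_option (\<lambda>x. \<ominus>\<^bsub>induced_ring M S\<^esub> x) \<circ> a) = Some (\<ominus>\<^bsub>induced_ring M S\<^esub> sumval S a))"

definition ordinal_reindexing_invariance :: "('v::set_universe, 'x) summation \<Rightarrow> bool" where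
  "ordinal_reindexing_invariance S \<longleftrightarrow>
     (\<forall>a \<in> dom S. \<forall>I' \<phi>. Ball (dom a) is_ord \<longrightarrow> Ball I' is_ord \<longrightarrow> ord_iso \<phi> I' (dom a) \<longrightarrow>
        (a \<circ> \<phi>) |` I' \<in> dom S \<and> S ((a \<circ> \<phi>) |` I') = S a)"

definition initial_summability :: "('v::set_universe, 'x) summation \<Rightarrow> bool" where
  "initial_summability S \<longleftrightarrow>
     (\<forall>a \<in> dom S. \<forall>\<alpha>. Ball (dom a) is_ord \<longrightarrow> is_ord \<alpha> \<longrightarrow>
        a |` {j \<in> dom a. j \<in> elts \<alpha>} \<in> dom S)"

definition postfix_associativity :: "('v::set_universe, 'x) summation \<Rightarrow> bool" where
  "postfix_associativity S \<longleftrightarrow>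
     (\<forall>a \<in> dom S. \<forall>m \<in> dom a. Ball (dom a) is_ord \<longrightarrow>
        (\<forall>i \<in> dom a. i = m \<or> i \<in> elts m) \<longrightarrow>
        a |` (dom a - {m}) \<in> dom S \<and>
        S a = induced_add S (sumval S (a |` (dom a - {m}))) (the (a m)))"

definition ordinal_insertive_associativity :: "('v::set_universe, 'x) summation \<Rightarrow> bool" where
  "ordinal_insertive_associativity S \<longleftrightarrow>
     (\<forall>a \<in> dom S. \<forall>K J. Ball (dom a) is_ord \<longrightarrow>
        disjoint_family_on J K \<longrightarrow> (\<Union>k\<in>K. J k) = dom a \<longrightarrow>
        (\<forall>k\<in>K. ord_subinterval (J k) (dom a) \<and> k \<in> J k) \<longrightarrow>
        (\<forall>k\<in>K. a |` J k \<in> dom S) \<and>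
        S a = S (fam K (\<lambda>k. sumval S (a |` J k))))"

definition infinite_distributivity ::
    "('x, 'm) monoid_scheme \<Rightarrow> ('v::set_universe, 'x) summation \<Rightarrow> bool" where
  "infinite_distributivity M S \<longleftrightarrow>
     (\<forall>a \<in> dom S. \<forall>b \<in> dom S.
        S (fam_by (\<lambda>(i, j). vpair i j) (dom a \<times> dom b) (\<lambda>(i, j). the (a i) \<otimes>\<^bsub>M\<^esub> the (b j)))
          = Some (sumval S a \<otimes>\<^bsub>M\<^esub> sumval S b))"

definition left_multiple_summability ::
    "('x, 'm) monoid_scheme \<Rightarrow> ('v, 'x) summation \<Rightarrow> bool" where
  "left_multiple_summability M S \<longleftrightarrow>
     (\<forall>a \<in> dom S. \<forall>r \<in> dom a \<rightarrow> carrier M. fam (dom a) (\<lambda>i. r i \<otimes>\<^bsub>M\<^esub> the (a i)) \<in> dom S)"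

definition left_reorderability ::
    "('x, 'm) monoid_scheme \<Rightarrow> ('v::set_universe, 'x) summation \<Rightarrow> bool" where
  "left_reorderability M S \<longleftrightarrow>
     (\<forall>a \<in> dom S. \<forall>r \<in> families (carrier M). \<forall>\<psi> \<in> dom r \<rightarrow> Pow (dom a).
        (\<forall>i \<in> dom a. r |` dual_map (dom r) \<psi> i \<in> dom S) \<longrightarrow>
        (let b = fam (dom a) (\<lambda>i. sumval S (r |` dual_map (dom r) \<psi> i) \<otimes>\<^bsub>M\<^esub> the (a i));
             c = fam (dom r) (\<lambda>k. the (r k) \<otimes>\<^bsub>M\<^esub> sumval S (a |` \<psi> k))
         in (\<forall>k \<in> dom r. a |` \<psi> k \<in> dom S) \<and> b \<in> dom S \<and> c \<in> dom S \<and> S b = S c))"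

end

(* Left reorderability with all coefficients 1 gives merging of partitions, hence reindexing;
   with a constant family on one side it gives distributivity. The addition is made total by
   bracketing (1, -1, (-1)(-1)) in two ways, which yields (-1)(-1) = 1; then every pair (x, y) is a
   left multiple (x 1, (y (-1)) (-1)) of (1, -1). Finally, reordering the pair (1, 1) shows that a
   disjoint union of two summable families sums to the sum of their sums, from which the ring
   axioms and the remaining properties follow. *)

theory Submission
  imports Defs
begin

text \<open>At the outset the only families known to be summable are (), (1), (1, -1) and, by
  surjectivity, some unspecified family for each value. Even the singleton (x) has to be earned: x
  is the sum of some family, and collapsing that family into one block leaves (x). Zero enters
  through empty fibres: an index that belongs to no \<open>\<psi> k\<close> receives an empty sum of
  coefficients. The obstacle to x + y is that reorderability scales from the left only. Scaling (1,
  -1) reaches just the pairs whose second entry is a left multiple of -1, so -1 must have a left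
  inverse. The usual proof that (-1)(-1) = 1 adds three elements, but no such sum may be formed by
  adding; the triple has to come out of reorderability already summable. Index sets must stay in a
  universe that need not be closed under power sets, so products and sets of blocks are shown small
  through images and unions.\<close>

section \<open>Small sets and pairs\<close>

lemma small_subset: "small A \<Longrightarrow> B \<subseteq> A \<Longrightarrow> small B"
  unfolding small_def by (rule small_subset_ax)

lemma small_image:
  fixes f :: "'v::set_universe \<Rightarrow> 'v"
  shows "small A \<Longrightarrow> small (f ` A)"
  unfolding small_def by (rule small_image_ax)

lemma small_elts [simp]: "small (elts x)"
  by (simp add: small_def)

lemma small_doubleton: "small {x, y}"
  unfolding small_def by (rule small_pair_ax)

lemma small_empty [simp]: "small {}"
  using small_subset[OF small_elts] by blast

lemma small_singleton [simp]: "small {x}"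
  using small_doubleton[of x x] by simp

text \<open>The union axiom speaks of the members of a small collection of elements; replacing each
  \<open>B x\<close> by its code \<open>vset (B x)\<close> brings the union into that form.\<close>

lemma small_UN:
  fixes A :: "'v::set_universe set" and B :: "'v \<Rightarrow> 'v set"
  assumes "small A" "\<And>x. x \<in> A \<Longrightarrow> small (B x)"
  shows "small (\<Union>x\<in>A. B x)"
proof -
  have "small ((\<lambda>x. vset (B x)) ` A)"
    using assms(1) by (rule small_image)
  then have "small (\<Union>y\<in>(\<lambda>x. vset (B x)) ` A. elts y)"
    unfolding small_def by (rule small_Union_ax)
  also have "(\<Union>y\<in>(\<lambda>x. vset (B x)) ` A. elts y) = (\<Union>x\<in>A. B x)"
    using assms(2) by (auto simp: elts_vset)
  finally show ?thesis .
qed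

lemma small_Un:
  assumes "small A" "small B"
  shows "small (A \<union> B)"
proof -
  have "small (\<Union>x\<in>{vset A, vset B}. elts x)"
    by (intro small_UN small_doubleton) simp
  then show ?thesis using assms by (simp add: elts_vset)
qed

lemma small_insert [simp]: "small A \<Longrightarrow> small (insert x A)"
  using small_Un[of "{x}" A] by simp

lemma vset_inject: "small A \<Longrightarrow> small B \<Longrightarrow> vset A = vset B \<longleftrightarrow> A = B"
  by (metis elts_vset)

lemma vpair_inject [simp]: "vpair x y = vpair x' y' \<longleftrightarrow> x = x' \<and> y = y'"
  by (auto simp: vpair_def vset_inject doubleton_eq_iff)

lemma not_in_elts_self: "x \<notin> elts x"
  using wf_elts wf_not_refl by fastforce

lemma elts_vnat_Suc: "elts (vnat (Suc n)) = insert (vnat n) (elts (vnat n))"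
  by (simp add: elts_vset)

lemma vnat_less_in_elts: "m < n \<Longrightarrow> vnat m \<in> elts (vnat n)"
  by (induction n) (auto simp: elts_vnat_Suc less_Suc_eq simp del: vnat.simps)

text \<open>For m < n the numeral of m is a member of that of n, and foundation forbids a set to be
  a member of itself.\<close>

lemma inj_vnat: "inj vnat"
  by (rule injI) (metis linorder_neqE_nat not_in_elts_self vnat_less_in_elts)

lemma vnat_inject [simp]: "vnat m = vnat n \<longleftrightarrow> m = n"
  by (rule inj_eq[OF inj_vnat])

declare vnat.simps [simp del]

section \<open>Families\<close>

lemma dom_fam [simp]: "dom (fam I f) = I"
  by (auto simp: fam_def split: if_splits)

lemma fam_apply [simp]: "i \<in> I \<Longrightarrow> fam I f i = Some (f i)"
  by (simp add: fam_def)

lemma fam_cong: "(\<And>i. i \<in> I \<Longrightarrow> f i = g i) \<Longrightarrow> fam I f = fam I g"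
  by (auto simp: fam_def)

lemma fam_restrict: "fam I f |` J = fam (I \<inter> J) f"
  by (auto simp: fam_def restrict_map_def)

lemma fam_dom [simp]: "fam (dom a) (\<lambda>i. the (a i)) = a"
  by (auto simp: fam_def domIff)

lemma restrict_eq_fam: "J \<subseteq> dom a \<Longrightarrow> a |` J = fam J (\<lambda>i. the (a i))"
  by (subst fam_dom[of a, symmetric], simp only: fam_restrict) (simp add: Int_absorb1)

lemma ran_fam: "ran (fam I f) = f ` I"
  by (auto simp: ran_def fam_def)

lemma fam_in_families: "fam I f \<in> families X \<longleftrightarrow> small I \<and> f \<in> I \<rightarrow> X"
  by (auto simp: families_def ran_fam)

lemma fam_empty: "fam {} f = Map.empty"
  by (simp add: fam_def)

lemma pair_fam_eq_fam:
  "pair_fam x y = fam {vnat 0, vnat 1} (\<lambda>i. if i = vnat 0 then x else y)"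
  by (auto simp: pair_fam_def fam_def fun_eq_iff)

section \<open>Sums under left reorderability\<close>

locale left_reorderable_summation = monoid M for M (structure) +
  fixes S :: "('v::set_universe, 'a) summation" and neg_one
  assumes system: "summation_system (carrier M) S"
    and reorderable: "left_reorderability M S"
    and surjective: "ran S = carrier M"
    and unit_singleton: "S [i \<mapsto> \<one>] = Some \<one>"
    and neg_one_closed: "neg_one \<in> carrier M"
    and empty_summable: "Map.empty \<in> dom S"
    and unit_neg_one: "S (pair_fam \<one> neg_one) = S Map.empty"
begin

text \<open>A relation, so that existence of the sum is part of the statement. Keeping the index set
  apart from a total function lets one \<open>f\<close> serve many index sets: passing to a
  subfamily or a union changes only \<open>I\<close>.\<close>

definition sums_to :: "'v set \<Rightarrow> ('v \<Rightarrow> 'a) \<Rightarrow> 'a \<Rightarrow> bool" where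
  "sums_to I f x \<longleftrightarrow> S (fam I f) = Some x"

definition zer :: 'a where
  "zer = sumval S Map.empty"

text \<open>Made total by \<open>the\<close>; the value carries information only once
  \<open>pair_summable\<close> is available.\<close>

definition plus :: "'a \<Rightarrow> 'a \<Rightarrow> 'a" (infixl \<open>+\<^sub>S\<close> 65) where
  "x +\<^sub>S y = the (S (pair_fam x y))"

lemma sums_to_sumval: "sums_to I f x \<Longrightarrow> sumval S (fam I f) = x"
  by (simp add: sums_to_def sumval_def)

lemma sums_to_small: "sums_to I f x \<Longrightarrow> small I"
  and sums_to_mem: "sums_to I f x \<Longrightarrow> f \<in> I \<rightarrow> carrier M"
  using system unfolding summation_system_def sums_to_def
  by (metis domI fam_in_families subsetD)+

lemma sums_to_closed: "sums_to I f x \<Longrightarrow> x \<in> carrier M"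
  using surjective by (auto simp: sums_to_def ran_def)

lemma sums_to_unique: "sums_to I f x \<Longrightarrow> sums_to I f y \<Longrightarrow> x = y"
  by (simp add: sums_to_def)

lemma sums_to_cong: "sums_to I f x \<Longrightarrow> (\<And>i. i \<in> I \<Longrightarrow> f i = g i) \<Longrightarrow> sums_to I g x"
  unfolding sums_to_def using fam_cong by metis

lemma sums_to_empty: "sums_to {} f zer"
  using empty_summable by (auto simp: sums_to_def fam_empty zer_def sumval_def)

lemma zer_closed [simp]: "zer \<in> carrier M"
  using sums_to_empty by (rule sums_to_closed)

lemma S_empty: "S Map.empty = Some zer"
  using sums_to_empty by (simp add: sums_to_def fam_empty)

text \<open>Elimination form of left reorderability: \<open>A k\<close> is the inner sum over
  \<open>\<psi> k\<close>, \<open>R i\<close> the sum of coefficients over the dual fibre of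
  \<open>i\<close>, and \<open>t\<close> the common value. Most facts about sums below arise from a
  choice of \<open>a\<close>, \<open>r\<close> and \<open>\<psi>\<close>.\<close>

lemma reorder:
  assumes a: "sums_to I a s" and K: "small K" and r: "r \<in> K \<rightarrow> carrier M"
    and \<psi>: "\<And>k. k \<in> K \<Longrightarrow> \<psi> k \<subseteq> I"
    and R: "\<And>i. i \<in> I \<Longrightarrow> sums_to {k \<in> K. i \<in> \<psi> k} r (R i)"
  obtains A t where "\<And>k. k \<in> K \<Longrightarrow> sums_to (\<psi> k) a (A k)"
    "sums_to I (\<lambda>i. R i \<otimes> a i) t" "sums_to K (\<lambda>k. r k \<otimes> A k) t"
proof -
  let ?a = "fam I a" and ?r = "fam K r"
  define A where "A k = sumval S (fam (\<psi> k) a)" for k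
  have restr: "fam I a |` \<psi> k = fam (\<psi> k) a" if "k \<in> K" for k
    using \<psi>[OF that] by (simp add: fam_restrict Int_absorb1)
  have dual: "fam K r |` dual_map K \<psi> i = fam {k \<in> K. i \<in> \<psi> k} r" for i
    by (simp add: fam_restrict dual_map_def Int_def)
  have "?a \<in> dom S" "?r \<in> families (carrier M)" "\<psi> \<in> dom ?r \<rightarrow> Pow (dom ?a)"
    using a K r \<psi> by (auto simp: sums_to_def fam_in_families)
  moreover have "\<forall>i \<in> dom ?a. ?r |` dual_map (dom ?r) \<psi> i \<in> dom S"
    using R by (auto simp: dual sums_to_def)
  ultimately have *: "let b = fam (dom ?a) (\<lambda>i. sumval S (?r |` dual_map (dom ?r) \<psi> i) \<otimes> the (?a i));
             c = fam (dom ?r) (\<lambda>k. the (?r k) \<otimes> sumval S (?a |` \<psi> k))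
         in (\<forall>k \<in> dom ?r. ?a |` \<psi> k \<in> dom S) \<and> b \<in> dom S \<and> c \<in> dom S \<and> S b = S c"
    using reorderable unfolding left_reorderability_def by blast
  have b: "fam (dom ?a) (\<lambda>i. sumval S (?r |` dual_map (dom ?r) \<psi> i) \<otimes> the (?a i))
      = fam I (\<lambda>i. R i \<otimes> a i)"
    unfolding dom_fam by (rule fam_cong) (simp add: dual sums_to_sumval[OF R])
  have c: "fam (dom ?r) (\<lambda>k. the (?r k) \<otimes> sumval S (?a |` \<psi> k)) = fam K (\<lambda>k. r k \<otimes> A k)"
    unfolding dom_fam by (rule fam_cong) (simp add: restr A_def)
  from * obtain t where "S (fam I (\<lambda>i. R i \<otimes> a i)) = Some t" "S (fam K (\<lambda>k. r k \<otimes> A k)) = Some t"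
    unfolding b c Let_def by (metis domD)
  moreover have "S (fam (\<psi> k) a) = Some (A k)" if "k \<in> K" for k
    using * that unfolding Let_def A_def sumval_def by (force simp: restr)
  ultimately show ?thesis
    using that unfolding sums_to_def by blast
qed

section \<open>Subfamilies and singletons\<close>

lemma sums_to_unit: "f i = \<one> \<Longrightarrow> sums_to {i} f \<one>"
proof -
  assume "f i = \<one>"
  then have "fam {i} f = [i \<mapsto> \<one>]" by (auto simp: fam_def)
  then show ?thesis by (simp add: sums_to_def unit_singleton)
qed

text \<open>Take one outer index \<open>k\<close> with coefficient 1 and
  \<open>\<psi> k = J\<close>. The dual fibre of \<open>i\<close> is \<open>{k}\<close> or empty, so
  its coefficient sum is 1 or \<open>zer\<close>, and the inner sum over \<open>J\<close> exists.
  The second conclusion is what yields singletons.\<close>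

lemma sums_to_subset:
  assumes "sums_to I a s" "J \<subseteq> I"
  obtains t where "sums_to J a t" "sums_to {k} (\<lambda>_. t) t"
proof -
  \<comment> \<open>The products \<open>zer \<otimes> a i\<close> cannot be evaluated yet, so
    \<open>u\<close> is identified with \<open>t\<close> only when \<open>J = I\<close>. Hence two
    applications: to \<open>J\<close> inside \<open>I\<close>, then to \<open>J\<close> inside
    itself.\<close>
  have ex: "\<exists>t u. sums_to J a t \<and> sums_to {k} (\<lambda>_. t) u \<and> (J = I \<longrightarrow> u = t)"
    if a: "sums_to I a s" and J: "J \<subseteq> I" for I J a s
  proof -
    have "sums_to {k' \<in> {k}. i \<in> J} (\<lambda>_. \<one>) (if i \<in> J then \<one> else zer)" for i
      by (auto simp: sums_to_empty sums_to_unit)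
    with a obtain A u where *: "sums_to J a (A k)" "sums_to {k} (\<lambda>k. \<one> \<otimes> A k) u"
        "sums_to I (\<lambda>i. (if i \<in> J then \<one> else zer) \<otimes> a i) u"
      using J
      by (rule_tac reorder[of I a s "{k}" "\<lambda>_. \<one>" "\<lambda>_. J" "\<lambda>i. if i \<in> J then \<one> else zer"]) auto
    have "sums_to {k} (\<lambda>_. A k) u"
      using *(2) by (rule sums_to_cong) (simp add: sums_to_closed[OF *(1)])
    moreover have "sums_to I a u" if "J = I"
      using *(3) by (rule sums_to_cong) (use sums_to_mem[OF a] that in \<open>auto simp: Pi_iff\<close>)
    ultimately show ?thesis using *(1) sums_to_unique by blast
  qed
  obtain t where t: "sums_to J a t"
    using ex[OF assms] by blast
  with ex[OF t order_refl] show ?thesis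
    using that sums_to_unique by metis
qed

text \<open>By surjectivity \<open>f i\<close> is the sum of some family; the previous lemma,
  applied to that whole family, turns it into a one-element family with the same sum.\<close>

lemma sums_to_singleton: "f i \<in> carrier M \<Longrightarrow> sums_to {i} f (f i)"
proof -
  assume "f i \<in> carrier M"
  then obtain a where "S a = Some (f i)"
    using surjective by (auto simp: ran_def)
  then have a: "sums_to (dom a) (\<lambda>i. the (a i)) (f i)"
    by (simp add: sums_to_def)
  obtain t where t: "sums_to (dom a) (\<lambda>i. the (a i)) t" "sums_to {i} (\<lambda>_. t) t"
    by (rule sums_to_subset[OF a order_refl])
  moreover have "t = f i" using t(1) a by (rule sums_to_unique)
  ultimately have "sums_to {i} (\<lambda>_. f i) (f i)" by simp
  then show ?thesis by (rule sums_to_cong) simp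
qed

section \<open>Distributivity and left multiples\<close>

text \<open>The base family is the singleton (y), and every \<open>\<psi> k\<close> is its index
  set; the one dual fibre is then all of \<open>K\<close>, with coefficient sum
  \<open>s\<close>.\<close>

lemma sums_to_distrib_right:
  assumes r: "sums_to K r s" and y: "y \<in> carrier M"
  shows "sums_to K (\<lambda>k. r k \<otimes> y) (s \<otimes> y)"
proof -
  \<comment> \<open>Any element of the universe can serve as the single index.\<close>
  let ?i = "undefined"
  have s: "s \<in> carrier M" using r by (rule sums_to_closed)
  have "sums_to {?i} (\<lambda>_. y) y" using y by (rule sums_to_singleton)
  then obtain A t where *: "\<And>k. k \<in> K \<Longrightarrow> sums_to {?i} (\<lambda>_. y) (A k)"
      "sums_to {?i} (\<lambda>i. s \<otimes> y) t" "sums_to K (\<lambda>k. r k \<otimes> A k) t"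
    using r by (rule_tac reorder[of "{?i}" "\<lambda>_. y" y K r "\<lambda>_. {?i}" "\<lambda>_. s"])
      (auto dest: sums_to_small sums_to_mem)
  have "A k = y" if "k \<in> K" for k
    using *(1)[OF that] sums_to_singleton[of "\<lambda>_. y"] y sums_to_unique by blast
  with *(3) have "sums_to K (\<lambda>k. r k \<otimes> y) t" by (elim sums_to_cong) auto
  moreover have "t = s \<otimes> y"
    using *(2) sums_to_singleton[of "\<lambda>_. s \<otimes> y"] s y sums_to_unique by blast
  ultimately show ?thesis by simp
qed

text \<open>The mirror choice: one outer index with coefficient \<open>x\<close>, whose
  \<open>\<psi>\<close>-value is all of \<open>I\<close>.\<close>

lemma sums_to_distrib_left:
  assumes a: "sums_to I a s" and x: "x \<in> carrier M"
  shows "sums_to I (\<lambda>i. x \<otimes> a i) (x \<otimes> s)"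
proof -
  let ?k = "undefined"
  obtain A t where *: "sums_to I a (A ?k)"
      "sums_to I (\<lambda>i. x \<otimes> a i) t" "sums_to {?k} (\<lambda>k. x \<otimes> A k) t"
    using a x by (rule_tac reorder[of I a s "{?k}" "\<lambda>_. x" "\<lambda>_. I" "\<lambda>_. x"])
      (auto intro: sums_to_singleton)
  have "A ?k = s" using *(1) a by (rule sums_to_unique)
  moreover have "t = x \<otimes> A ?k"
    using *(3) sums_to_singleton[of "\<lambda>k. x \<otimes> A k" ?k] x sums_to_closed[OF *(1)] sums_to_unique
    by blast
  ultimately show ?thesis using *(2) by simp
qed

text \<open>Distributivity over the empty family, which remains empty after multiplication.\<close>

lemma zer_mult [simp]: "x \<in> carrier M \<Longrightarrow> zer \<otimes> x = zer"
  using sums_to_distrib_right[OF sums_to_empty] sums_to_empty sums_to_unique by metis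

lemma mult_zer [simp]: "x \<in> carrier M \<Longrightarrow> x \<otimes> zer = zer"
  using sums_to_distrib_left[OF sums_to_empty] sums_to_empty sums_to_unique by metis

text \<open>With \<open>\<psi> k = {k}\<close> each dual fibre is a singleton, so its coefficient
  sum is \<open>r i\<close> itself. Only summability results; \<open>s\<close> does not determine
  the value.\<close>

lemma sums_to_left_multiple:
  assumes a: "sums_to I a s" and r: "r \<in> I \<rightarrow> carrier M"
  obtains t where "sums_to I (\<lambda>i. r i \<otimes> a i) t"
proof -
  have "sums_to {k \<in> I. i \<in> {k}} r (r i)" if "i \<in> I" for i
  proof -
    have "{k \<in> I. i \<in> {k}} = {i}" using that by auto
    then show ?thesis using r that by (auto intro: sums_to_singleton)
  qed
  then show ?thesis
    using reorder[OF a sums_to_small[OF a] r, of "\<lambda>k. {k}" r] that by auto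
qed

section \<open>Merging, reindexing and extension by zeros\<close>

text \<open>As exactly one \<open>\<psi> k\<close> contains \<open>i\<close>, each dual fibre is a
  singleton, so only the sum of (1) is needed. The sets \<open>\<psi> k\<close> may be
  empty.\<close>

lemma sums_to_merge:
  assumes a: "sums_to I a s" and K: "small K" and \<psi>: "\<And>k. k \<in> K \<Longrightarrow> \<psi> k \<subseteq> I"
    and ex1: "\<And>i. i \<in> I \<Longrightarrow> \<exists>!k. k \<in> K \<and> i \<in> \<psi> k"
  obtains A where "\<And>k. k \<in> K \<Longrightarrow> sums_to (\<psi> k) a (A k)" "sums_to K A s"
proof -
  have "sums_to {k \<in> K. i \<in> \<psi> k} (\<lambda>_. \<one>) \<one>" if i: "i \<in> I" for i
  proof -
    obtain k where "{k \<in> K. i \<in> \<psi> k} = {k}"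
      using ex1[OF i] by (auto elim!: ex1E)
    then show ?thesis by (simp add: sums_to_unit)
  qed
  then obtain A t where *: "\<And>k. k \<in> K \<Longrightarrow> sums_to (\<psi> k) a (A k)"
      "sums_to I (\<lambda>i. \<one> \<otimes> a i) t" "sums_to K (\<lambda>k. \<one> \<otimes> A k) t"
    using reorder[OF a K, of "\<lambda>_. \<one>" \<psi> "\<lambda>_. \<one>"] \<psi> by auto
  have "sums_to I a t"
    using *(2) by (rule sums_to_cong) (use sums_to_mem[OF a] in \<open>auto simp: Pi_iff\<close>)
  with a have "t = s" by (blast intro: sums_to_unique)
  moreover have "sums_to K A t"
    using *(3) by (rule sums_to_cong) (use sums_to_closed[OF *(1)] in auto)
  ultimately show ?thesis using that *(1) by blast
qed

lemma sums_to_reindex: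
  assumes a: "sums_to I a s" and \<phi>: "bij_betw \<phi> K I"
  shows "sums_to K (\<lambda>k. a (\<phi> k)) s"
proof -
  \<comment> \<open>Smallness of \<open>K\<close> is inherited from \<open>I\<close> through the
    inverse bijection; the blocks to merge are then the singletons
    \<open>{\<phi> k}\<close>.\<close>
  have "K = inv_into K \<phi> ` I"
    using bij_betw_imp_surj_on[OF bij_betw_inv_into[OF \<phi>]] by simp
  then have "small K"
    using small_image[OF sums_to_small[OF a]] by metis
  moreover have "{\<phi> k} \<subseteq> I" if "k \<in> K" for k
    using \<phi> that by (auto dest: bij_betwE)
  moreover have "\<exists>!k. k \<in> K \<and> i \<in> {\<phi> k}" if "i \<in> I" for i
    using \<phi> that by (auto simp: bij_betw_def inj_on_def)
  ultimately obtain A where A: "\<And>k. k \<in> K \<Longrightarrow> sums_to {\<phi> k} a (A k)" "sums_to K A s"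
    using sums_to_merge[OF a, of K "\<lambda>k. {\<phi> k}"] by blast
  have "A k = a (\<phi> k)" if "k \<in> K" for k
    using A(1)[OF that] sums_to_mem[OF A(1)[OF that]]
    by (intro sums_to_unique[OF A(1)[OF that]] sums_to_singleton) auto
  then show ?thesis using A(2) by (elim sums_to_cong) auto
qed

lemma sums_to_image_iff:
  assumes e: "inj_on e I"
  shows "sums_to (e ` I) h s \<longleftrightarrow> sums_to I (\<lambda>i. h (e i)) s"
proof
  assume "sums_to (e ` I) h s"
  then show "sums_to I (\<lambda>i. h (e i)) s"
    by (rule sums_to_reindex) (rule inj_on_imp_bij_betw[OF e])
next
  assume "sums_to I (\<lambda>i. h (e i)) s"
  then have "sums_to (e ` I) (\<lambda>k. h (e (inv_into I e k))) s"
    by (rule sums_to_reindex[where a = "\<lambda>i. h (e i)"])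
      (rule bij_betw_inv_into[OF inj_on_imp_bij_betw[OF e]])
  then show "sums_to (e ` I) h s"
    by (rule sums_to_cong) (simp add: f_inv_into_f)
qed

text \<open>With \<open>\<psi> k = {k} \<inter> I\<close>, an index outside \<open>I\<close>
  receives an empty inner sum, so the outer family acquires the entry \<open>zer\<close>
  there.\<close>

lemma sums_to_zero_extension:
  assumes a: "sums_to I a s" and L: "small L" "I \<subseteq> L" and z: "\<And>i. i \<in> L - I \<Longrightarrow> a i = zer"
  shows "sums_to L a s"
proof -
  have "sums_to {k \<in> L. i \<in> {k} \<inter> I} (\<lambda>_. \<one>) \<one>" if "i \<in> I" for i
  proof -
    have "{k \<in> L. i \<in> {k} \<inter> I} = {i}" using that L by auto
    then show ?thesis by (simp add: sums_to_unit)
  qed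
  then obtain A t where *: "\<And>k. k \<in> L \<Longrightarrow> sums_to ({k} \<inter> I) a (A k)"
      "sums_to I (\<lambda>i. \<one> \<otimes> a i) t" "sums_to L (\<lambda>k. \<one> \<otimes> A k) t"
    using reorder[OF a L(1), of "\<lambda>_. \<one>" "\<lambda>k. {k} \<inter> I" "\<lambda>_. \<one>"] by auto
  have "sums_to I a t"
    using *(2) by (rule sums_to_cong) (use sums_to_mem[OF a] in \<open>auto simp: Pi_iff\<close>)
  with a have "t = s" by (blast intro: sums_to_unique)
  have "A k = a k" if "k \<in> L" for k
  proof (cases "k \<in> I")
    case True
    then have "sums_to {k} a (A k)" using *(1)[OF that] by simp
    moreover have "sums_to {k} a (a k)"
      using sums_to_mem[OF a] True by (intro sums_to_singleton) auto
    ultimately show ?thesis by (rule sums_to_unique)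
  next
    case False
    then have "sums_to {} a (A k)" using *(1)[OF that] by simp
    then have "A k = zer" using sums_to_empty by (rule sums_to_unique)
    then show ?thesis using z that False by simp
  qed
  then have "\<And>k. k \<in> L \<Longrightarrow> \<one> \<otimes> A k = a k"
    using sums_to_closed[OF *(1)] by simp
  with *(3) have "sums_to L a t" by (rule sums_to_cong)
  with \<open>t = s\<close> show ?thesis by simp
qed

text \<open>For the converse, the subfamily over \<open>I\<close> has some sum; extending it back to
  \<open>L\<close> and comparing identifies that sum with \<open>s\<close>.\<close>

lemma sums_to_zero_extension_iff:
  assumes "small L" "I \<subseteq> L" "\<And>i. i \<in> L - I \<Longrightarrow> a i = zer"
  shows "sums_to L a s \<longleftrightarrow> sums_to I a s"
proof
  assume s: "sums_to L a s"
  obtain t where t: "sums_to I a t" by (rule sums_to_subset[OF s assms(2)])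
  then have "sums_to L a t" using assms by (rule sums_to_zero_extension)
  with s t show "sums_to I a s" using sums_to_unique by blast
qed (rule sums_to_zero_extension[OF _ assms])

section \<open>Finite sums\<close>

text \<open>Evaluates pairs with a zero entry at a stage where addition is still partial.\<close>

lemma sums_to_doubleton_zer:
  assumes "f q = zer" "f p \<in> carrier M"
  shows "sums_to {p, q} f (f p)"
  by (rule sums_to_zero_extension[OF sums_to_singleton]) (use assms in auto)

text \<open>Frees the sum of (1, -1) from the indices \<open>vnat 0\<close> and
  \<open>vnat 1\<close>.\<close>

lemma neg_one_sum:
  assumes "p \<noteq> q" "f p = \<one>" "f q = neg_one"
  shows "sums_to {p, q} f zer"
proof -
  have sum: "sums_to {vnat 0, vnat 1} (\<lambda>i. if i = vnat 0 then \<one> else neg_one) zer"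
    using unit_neg_one by (simp add: sums_to_def pair_fam_eq_fam S_empty)
  have "bij_betw (\<lambda>i. if i = p then vnat 0 else vnat 1) {p, q} {vnat 0, vnat 1}"
    using assms(1) by (auto simp: bij_betw_def inj_on_def)
  from sums_to_reindex[OF sum this] show ?thesis
    by (rule sums_to_cong) (use assms in auto)
qed

text \<open>Both \<open>\<one> + (-\<one> + (-\<one>)(-\<one>))\<close> and \<open>(\<one> + -\<one>) + (-\<one>)(-\<one>)\<close> come from one summable
  family indexed by three elements; no additivity is available yet.\<close>

lemma neg_one_squared: "neg_one \<otimes> neg_one = \<one>"
proof -
  define p q u :: 'v where "p = vnat 0" and "q = vnat 1" and "u = vnat 2"
  have ne: "p \<noteq> q" "q \<noteq> u" "p \<noteq> u"
    by (simp_all add: p_def q_def u_def)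
  let ?a = "\<lambda>i. if i = p then \<one> else neg_one"
  \<comment> \<open>The function \<open>?a\<close> is both the base family (1, -1) on
    \<open>{p, q}\<close> and the coefficient family (1, -1, -1) on \<open>{p, q, u}\<close>. The
    dual fibre of \<open>p\<close> is \<open>{p, q}\<close>, with sum \<open>zer\<close>; that of
    \<open>q\<close> is \<open>{u}\<close>, with sum -1. So one side of the reordering is (zer 1,
    (-1)(-1)) and the other is the triple (1, -1, (-1)(-1)).\<close>
  let ?\<psi> = "\<lambda>k. if k = u then {q} else {p}"
  let ?R = "\<lambda>i. if i = p then zer else neg_one"
  note [simp] = neg_one_closed
  have small: "small {p, q, u}" by simp
  have a: "sums_to {p, q} ?a zer"
    using ne by (intro neg_one_sum) auto
  have R: "sums_to {k \<in> {p, q, u}. i \<in> ?\<psi> k} ?a (?R i)" if "i \<in> {p, q}" for i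
  proof (cases "i = p")
    case True
    then have "{k \<in> {p, q, u}. i \<in> ?\<psi> k} = {p, q}" using ne by auto
    then show ?thesis using a True by simp
  next
    case False
    then have "{k \<in> {p, q, u}. i \<in> ?\<psi> k} = {u}" using ne that by auto
    then show ?thesis using sums_to_singleton[of ?a u] ne False by simp
  qed
  obtain A t where *: "\<And>k. k \<in> {p, q, u} \<Longrightarrow> sums_to (?\<psi> k) ?a (A k)"
      "sums_to {p, q} (\<lambda>i. ?R i \<otimes> ?a i) t" "sums_to {p, q, u} (\<lambda>k. ?a k \<otimes> A k) t"
    by (rule reorder[OF a small, of ?a ?\<psi> ?R]) (use R in auto)
  have "sums_to {q, p} (\<lambda>i. ?R i \<otimes> ?a i) (?R q \<otimes> ?a q)"
    using ne by (intro sums_to_doubleton_zer) auto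
  then have "sums_to {p, q} (\<lambda>i. ?R i \<otimes> ?a i) (?R q \<otimes> ?a q)"
    by (simp only: insert_commute)
  then have "t = ?R q \<otimes> ?a q"
    by (rule sums_to_unique[OF *(2)])
  then have t: "t = neg_one \<otimes> neg_one"
    using ne by simp
  let ?f = "\<lambda>k. if k = p then \<one> else if k = q then neg_one else neg_one \<otimes> neg_one"
  have A: "A k = (if k = u then neg_one else \<one>)" if "k \<in> {p, q, u}" for k
  proof (cases "k = u")
    case True
    then show ?thesis
      using *(1)[OF that] sums_to_singleton[of ?a q] ne sums_to_unique by auto
  next
    case False
    then show ?thesis
      using *(1)[OF that] sums_to_singleton[of ?a p] sums_to_unique by auto
  qed
  have f: "sums_to {p, q, u} ?f t"
    using *(3) by (rule sums_to_cong) (use A ne in auto)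
  \<comment> \<open>The other bracketing sets \<open>p\<close> apart. On \<open>{q, u}\<close> the
    triple is -1 times (1, -1), which sums to \<open>zer\<close> by left distributivity, so the
    total is 1.\<close>
  let ?\<chi> = "\<lambda>k. if k = p then {p} else {q, u}"
  have "\<exists>!k. k \<in> {p, q} \<and> i \<in> ?\<chi> k" if "i \<in> {p, q, u}" for i
    by (rule ex1I[of _ "if i = p then p else q"]) (use ne that in \<open>auto split: if_splits\<close>)
  then obtain B where B: "\<And>k. k \<in> {p, q} \<Longrightarrow> sums_to (?\<chi> k) ?f (B k)" "sums_to {p, q} B t"
    by (rule_tac sums_to_merge[OF f, of "{p, q}" ?\<chi>]) auto
  have "sums_to {p} ?f (?f p)" by (rule sums_to_singleton) simp
  then have "B p = \<one>" using B(1)[of p] sums_to_unique by auto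
  have "sums_to {q, u} (\<lambda>i. if i = q then \<one> else neg_one) zer"
    using ne by (intro neg_one_sum) auto
  then have "sums_to {q, u} (\<lambda>i. neg_one \<otimes> (if i = q then \<one> else neg_one)) (neg_one \<otimes> zer)"
    by (rule sums_to_distrib_left) simp
  then have "sums_to {q, u} ?f zer"
    using ne by (simp, elim sums_to_cong) auto
  then have "B q = zer" using B(1)[of q] ne sums_to_unique by auto
  then have "sums_to {p, q} B (B p)"
    by (rule sums_to_doubleton_zer) (simp add: \<open>B p = \<one>\<close>)
  with B(2) \<open>B p = \<one>\<close> t show ?thesis using sums_to_unique by metis
qed

section \<open>Totality of addition and disjoint unions\<close>

lemma pair_summable:
  assumes "x \<in> carrier M" "y \<in> carrier M"
  shows "S (pair_fam x y) = Some (x +\<^sub>S y)"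
proof -
  let ?p = "vnat 0 :: 'v" and ?q = "vnat 1 :: 'v"
  let ?a = "\<lambda>i. if i = ?p then \<one> else neg_one"
  let ?r = "\<lambda>i. if i = ?p then x else y \<otimes> neg_one"
  have "sums_to {?p, ?q} ?a zer"
    by (rule neg_one_sum) auto
  then obtain t where "sums_to {?p, ?q} (\<lambda>i. ?r i \<otimes> ?a i) t"
    by (rule sums_to_left_multiple[of _ _ _ ?r]) (use assms neg_one_closed in auto)
  then have "sums_to {?p, ?q} (\<lambda>i. if i = ?p then x else y) t"
    by (rule sums_to_cong)
      (use assms neg_one_closed in \<open>auto simp: m_assoc neg_one_squared\<close>)
  then show ?thesis
    by (simp add: sums_to_def plus_def pair_fam_eq_fam)
qed

lemma plus_closed [simp]: "x \<in> carrier M \<Longrightarrow> y \<in> carrier M \<Longrightarrow> x +\<^sub>S y \<in> carrier M"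
  using pair_summable surjective by (metis ranI)

text \<open>Here \<open>f\<close> supplies the coefficients rather than the base family, so its
  summability over \<open>I \<union> J\<close> is a conclusion. The dual fibres of the two base
  indices are \<open>I\<close> and \<open>J\<close>, and every inner sum is 1.\<close>

lemma sums_to_Un_disjoint:
  assumes I: "sums_to I f s" and J: "sums_to J f t" and disj: "I \<inter> J = {}"
  shows "sums_to (I \<union> J) f (s +\<^sub>S t)"
proof -
  let ?p = "vnat 0 :: 'v" and ?q = "vnat 1 :: 'v"
  have ne: "?p \<noteq> ?q" by simp
  let ?\<psi> = "\<lambda>k. if k \<in> I then {?p} else {?q}"
  let ?R = "\<lambda>i. if i = ?p then s else t"
  have pair: "sums_to {?p, ?q} (\<lambda>i. if i = ?p then x else y) (x +\<^sub>S y)"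
    if "x \<in> carrier M" "y \<in> carrier M" for x y
    using pair_summable[OF that] by (simp add: sums_to_def pair_fam_eq_fam)
  have one: "sums_to {?p, ?q} (\<lambda>_. \<one>) (\<one> +\<^sub>S \<one>)"
    using pair[of \<one> \<one>] by simp
  have "small (I \<union> J)" using I J by (intro small_Un) (auto dest: sums_to_small)
  have mem: "f \<in> I \<union> J \<rightarrow> carrier M" using sums_to_mem[OF I] sums_to_mem[OF J] by auto
  have "{k \<in> I \<union> J. ?p \<in> ?\<psi> k} = I" "{k \<in> I \<union> J. ?q \<in> ?\<psi> k} = J"
    using disj ne by (auto split: if_splits)
  then have R: "sums_to {k \<in> I \<union> J. i \<in> ?\<psi> k} f (?R i)" if "i \<in> {?p, ?q}" for i
    using that I J ne by (elim insertE) auto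
  obtain A u where *: "\<And>k. k \<in> I \<union> J \<Longrightarrow> sums_to (?\<psi> k) (\<lambda>_. \<one>) (A k)"
      "sums_to {?p, ?q} (\<lambda>i. ?R i \<otimes> \<one>) u" "sums_to (I \<union> J) (\<lambda>k. f k \<otimes> A k) u"
    by (rule reorder[OF one \<open>small (I \<union> J)\<close> mem, of ?\<psi> ?R]) (use R in auto)
  have "A k = \<one>" if "k \<in> I \<union> J" for k
    using *(1)[OF that] sums_to_unit[of "\<lambda>_. \<one>"] sums_to_unique by (auto split: if_splits)
  with *(3) have "sums_to (I \<union> J) f u"
    by (elim sums_to_cong) (use mem in \<open>auto simp: Pi_iff\<close>)
  moreover have "sums_to {?p, ?q} ?R u"
    using *(2) by (rule sums_to_cong) (use sums_to_closed[OF I] sums_to_closed[OF J] in auto)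
  then have "u = s +\<^sub>S t"
    using pair[of s t] sums_to_closed[OF I] sums_to_closed[OF J] sums_to_unique by blast
  ultimately show ?thesis by simp
qed

lemma sums_to_insert:
  assumes "sums_to I f s" "l \<notin> I" "f l \<in> carrier M"
  shows "sums_to (insert l I) f (s +\<^sub>S f l)"
  using sums_to_Un_disjoint[OF assms(1) sums_to_singleton[of f l]] assms by simp

lemma sums_to_doubleton:
  assumes "p \<noteq> q" "f p \<in> carrier M" "f q \<in> carrier M"
  shows "sums_to {p, q} f (f p +\<^sub>S f q)"
  using sums_to_insert[OF sums_to_singleton[of f p], of q] assms by (simp add: insert_commute)

section \<open>Laws of the addition\<close>

text \<open>Index sets are unordered: the same family over \<open>{p, q}\<close> is evaluated from
  either end.\<close>

lemma plus_commute:
  assumes "x \<in> carrier M" "y \<in> carrier M"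
  shows "x +\<^sub>S y = y +\<^sub>S x"
proof -
  let ?p = "vnat 0 :: 'v" and ?q = "vnat 1 :: 'v"
  let ?f = "\<lambda>i. if i = ?p then x else y"
  have ne: "?p \<noteq> ?q" by simp
  have xy: "sums_to {?p, ?q} ?f (?f ?p +\<^sub>S ?f ?q)"
    by (rule sums_to_doubleton) (use assms ne in auto)
  have "sums_to {?q, ?p} ?f (?f ?q +\<^sub>S ?f ?p)"
    by (rule sums_to_doubleton) (use assms ne in auto)
  then have "sums_to {?p, ?q} ?f (?f ?q +\<^sub>S ?f ?p)"
    by (simp only: insert_commute)
  with xy have "?f ?p +\<^sub>S ?f ?q = ?f ?q +\<^sub>S ?f ?p"
    by (rule sums_to_unique)
  then show ?thesis using ne by simp
qed

text \<open>One three-element family is built by adding \<open>u\<close> to \<open>{p, q}\<close>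
  and by adding \<open>p\<close> to \<open>{q, u}\<close>. A new entry always lands on the right, so
  commutativity has to finish.\<close>

lemma plus_assoc:
  assumes "x \<in> carrier M" "y \<in> carrier M" "z \<in> carrier M"
  shows "(x +\<^sub>S y) +\<^sub>S z = x +\<^sub>S (y +\<^sub>S z)"
proof -
  define p q u :: 'v where "p = vnat 0" and "q = vnat 1" and "u = vnat 2"
  have ne: "p \<noteq> q" "q \<noteq> u" "p \<noteq> u"
    by (simp_all add: p_def q_def u_def)
  define f where "f i = (if i = p then x else if i = q then y else z)" for i
  have f [simp]: "f p = x" "f q = y" "f u = z" using ne by (auto simp: f_def)
  have "sums_to (insert u {p, q}) f ((f p +\<^sub>S f q) +\<^sub>S f u)"
    by (intro sums_to_insert sums_to_doubleton) (use assms ne in auto)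
  moreover have "sums_to (insert p {q, u}) f ((f q +\<^sub>S f u) +\<^sub>S f p)"
    by (intro sums_to_insert sums_to_doubleton) (use assms ne in auto)
  moreover have "insert u {p, q} = insert p {q, u}" by auto
  ultimately have "(x +\<^sub>S y) +\<^sub>S z = (y +\<^sub>S z) +\<^sub>S x"
    using sums_to_unique by auto
  then show ?thesis using plus_commute assms by simp
qed

lemma plus_zer:
  assumes "x \<in> carrier M"
  shows "x +\<^sub>S zer = x"
proof -
  define p q :: 'v where "p = vnat 0" and "q = vnat 1"
  have ne: "p \<noteq> q" by (simp add: p_def q_def)
  let ?f = "\<lambda>i. if i = p then x else zer"
  have "sums_to {p, q} ?f (?f p +\<^sub>S ?f q)"
    by (rule sums_to_doubleton) (use assms ne in auto)
  moreover have "sums_to {p, q} ?f (?f p)"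
    by (rule sums_to_doubleton_zer) (use assms ne in auto)
  ultimately have "?f p +\<^sub>S ?f q = ?f p"
    by (rule sums_to_unique)
  then show ?thesis using ne by simp
qed

lemma plus_distrib:
  assumes x: "x \<in> carrier M" and y: "y \<in> carrier M" and z: "z \<in> carrier M"
  shows "z \<otimes> (x +\<^sub>S y) = z \<otimes> x +\<^sub>S z \<otimes> y" and "(x +\<^sub>S y) \<otimes> z = x \<otimes> z +\<^sub>S y \<otimes> z"
proof -
  define p q :: 'v where "p = vnat 0" and "q = vnat 1"
  have ne: "p \<noteq> q" by (simp add: p_def q_def)
  define f where "f i = (if i = p then x else y)" for i
  have f: "f p = x" "f q = y" using ne by (auto simp: f_def)
  have "sums_to {p, q} f (f p +\<^sub>S f q)"
    by (rule sums_to_doubleton) (use assms ne f in auto)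
  then have s: "sums_to {p, q} f (x +\<^sub>S y)" by (simp add: f)
  have "sums_to {p, q} (\<lambda>i. z \<otimes> f i) (z \<otimes> f p +\<^sub>S z \<otimes> f q)"
    by (rule sums_to_doubleton[where f = "\<lambda>i. z \<otimes> f i"]) (use assms ne f in auto)
  with sums_to_distrib_left[OF s z] show "z \<otimes> (x +\<^sub>S y) = z \<otimes> x +\<^sub>S z \<otimes> y"
    using sums_to_unique f by metis
  have "sums_to {p, q} (\<lambda>i. f i \<otimes> z) (f p \<otimes> z +\<^sub>S f q \<otimes> z)"
    by (rule sums_to_doubleton[where f = "\<lambda>i. f i \<otimes> z"]) (use assms ne f in auto)
  with sums_to_distrib_right[OF s z] show "(x +\<^sub>S y) \<otimes> z = x \<otimes> z +\<^sub>S y \<otimes> z"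
    using sums_to_unique f by metis
qed

text \<open>The relation 1 + (-1) = 0 multiplied on the right by \<open>x\<close>; it identifies the
  additive inverse.\<close>

lemma plus_neg_one_mult:
  assumes "x \<in> carrier M"
  shows "x +\<^sub>S neg_one \<otimes> x = zer"
proof -
  have "\<one> +\<^sub>S neg_one = zer"
    using pair_summable[OF one_closed neg_one_closed] unit_neg_one by (simp add: S_empty)
  then show ?thesis
    using plus_distrib(2)[of \<one> neg_one x] assms neg_one_closed by simp
qed

section \<open>Sums over pairs\<close>

text \<open>Two disjoint copies of \<open>I\<close>, tagged by \<open>p\<close> and
  \<open>q\<close>, carry \<open>f\<close> and \<open>g\<close>. Their union sums to
  \<open>s +\<^sub>S t\<close>, and merging the two points over each \<open>i\<close> gives the
  componentwise sum.\<close>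

lemma sums_to_plus:
  assumes f: "sums_to I f s" and g: "sums_to I g t"
  shows "sums_to I (\<lambda>i. f i +\<^sub>S g i) (s +\<^sub>S t)"
proof -
  define p q :: 'v where "p = vnat 0" and "q = vnat 1"
  have ne: "p \<noteq> q" by (simp add: p_def q_def)
  have "inj (\<lambda>(x, y). vpair x y :: 'v)" by (auto simp: inj_def)
  then have inv: "inv_into UNIV (\<lambda>(x, y). vpair x y :: 'v) (vpair c i) = (c, i)" for c i
    using inv_f_f[where x = "(c, i)"] by fastforce
  \<comment> \<open>Decodes the tag. Off the coded pairs \<open>inv_into\<close> is unspecified, but
    \<open>h\<close> is only summed over such pairs.\<close>
  define h where
    "h k = (case inv_into UNIV (\<lambda>(x, y). vpair x y) k of (c, i) \<Rightarrow> if c = p then f i else g i)" for k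
  have h: "h (vpair p i) = f i" "h (vpair q i) = g i" for i
    using ne by (simp_all add: h_def inv)
  have inj: "inj_on (vpair c) I" for c :: 'v by (simp add: inj_on_def)
  have "sums_to (vpair p ` I) h s" "sums_to (vpair q ` I) h t"
    using f g by (simp_all add: sums_to_image_iff[OF inj] h)
  then have u: "sums_to (vpair p ` I \<union> vpair q ` I) h (s +\<^sub>S t)"
    by (rule sums_to_Un_disjoint) (use ne in auto)
  obtain A where A: "\<And>i. i \<in> I \<Longrightarrow> sums_to {vpair p i, vpair q i} h (A i)" "sums_to I A (s +\<^sub>S t)"
    by (rule sums_to_merge[OF u sums_to_small[OF f], of "\<lambda>i. {vpair p i, vpair q i}"]) (use ne in auto)
  have "A i = f i +\<^sub>S g i" if "i \<in> I" for i
  proof -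
    have "sums_to {vpair p i, vpair q i} h (h (vpair p i) +\<^sub>S h (vpair q i))"
      by (rule sums_to_doubleton) (use ne h that sums_to_mem[OF f] sums_to_mem[OF g] in auto)
    then show ?thesis using A(1)[OF that] sums_to_unique h by metis
  qed
  with A(2) show ?thesis by (elim sums_to_cong)
qed

text \<open>The base family is \<open>b\<close>, the coefficient at a pair is the
  \<open>a\<close>-entry of its first component, and \<open>\<psi>\<close> takes the second
  component. The dual fibre of \<open>j\<close> is a copy of \<open>I\<close> with sum
  \<open>s\<close>, which leaves left distributivity over \<open>b\<close>.\<close>

lemma sums_to_product:
  assumes a: "sums_to I a s" and b: "sums_to J b t"
    and h: "\<And>i j. i \<in> I \<Longrightarrow> j \<in> J \<Longrightarrow> h (vpair i j) = a i \<otimes> b j"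
  shows "sums_to ((\<lambda>(i, j). vpair i j) ` (I \<times> J)) h (s \<otimes> t)"
proof -
  let ?K = "(\<lambda>(i, j). vpair i j) ` (I \<times> J)"
  have "inj (\<lambda>(x, y). vpair x y :: 'v)" by (auto simp: inj_def)
  then have inv: "inv_into UNIV (\<lambda>(x, y). vpair x y :: 'v) (vpair c i) = (c, i)" for c i
    using inv_f_f[where x = "(c, i)"] by fastforce
  define fst' snd' :: "'v \<Rightarrow> 'v" where "fst' k = fst (inv_into UNIV (\<lambda>(x, y). vpair x y) k)"
    and "snd' k = snd (inv_into UNIV (\<lambda>(x, y). vpair x y) k)" for k
  have [simp]: "fst' (vpair i j) = i" "snd' (vpair i j) = j" for i j
    by (simp_all add: fst'_def snd'_def inv)
  have "?K = (\<Union>i\<in>I. vpair i ` J)" by auto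
  then have K: "small ?K"
    using small_UN[OF sums_to_small[OF a], of "\<lambda>i. vpair i ` J"] small_image[OF sums_to_small[OF b]]
    by simp
  have R: "sums_to {k \<in> ?K. j \<in> {snd' k}} (\<lambda>k. a (fst' k)) s" if "j \<in> J" for j
  proof -
    have "{k \<in> ?K. j \<in> {snd' k}} = (\<lambda>i. vpair i j) ` I" using that by auto
    moreover have "inj_on (\<lambda>i. vpair i j) I" by (simp add: inj_on_def)
    ultimately show ?thesis using a by (simp add: sums_to_image_iff)
  qed
  obtain A u where *: "\<And>k. k \<in> ?K \<Longrightarrow> sums_to {snd' k} b (A k)"
      "sums_to J (\<lambda>j. s \<otimes> b j) u" "sums_to ?K (\<lambda>k. a (fst' k) \<otimes> A k) u"
    by (rule reorder[OF b K, of "\<lambda>k. a (fst' k)" "\<lambda>k. {snd' k}" "\<lambda>_. s"])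
      (use R sums_to_mem[OF a] in auto)
  have "u = s \<otimes> t"
    using *(2) sums_to_distrib_left[OF b sums_to_closed[OF a]] by (rule sums_to_unique)
  moreover have "A k = b (snd' k)" if "k \<in> ?K" for k
    using *(1)[OF that] sums_to_mem[OF *(1)[OF that]]
    by (intro sums_to_unique[OF *(1)[OF that]] sums_to_singleton) auto
  then have "sums_to ?K h u"
    by (intro sums_to_cong[OF *(3)]) (use h in force)
  ultimately show ?thesis by simp
qed

section \<open>The induced ring\<close>

lemma ring_induced: "ring (induced_ring M S)"
proof (rule ringI)
  let ?R = "induced_ring M S"
  have add: "x \<oplus>\<^bsub>?R\<^esub> y = x +\<^sub>S y" for x y
    by (simp add: induced_ring_def induced_add_def plus_def)
  have zero: "\<zero>\<^bsub>?R\<^esub> = zer" by (simp add: induced_ring_def zer_def)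
  have mult: "x \<otimes>\<^bsub>?R\<^esub> y = x \<otimes> y" for x y by (simp add: induced_ring_def)
  have one: "\<one>\<^bsub>?R\<^esub> = \<one>" by (simp add: induced_ring_def)
  have carrier: "carrier ?R = carrier M" by (simp add: induced_ring_def)
  note simps = add zero mult one carrier
  show "abelian_group ?R"
  proof (rule abelian_groupI)
    fix x assume "x \<in> carrier ?R"
    then show "\<exists>y\<in>carrier ?R. y \<oplus>\<^bsub>?R\<^esub> x = \<zero>\<^bsub>?R\<^esub>"
      using plus_neg_one_mult[of x] plus_commute[of x "neg_one \<otimes> x"] neg_one_closed
      by (auto simp: simps)
    show "\<zero>\<^bsub>?R\<^esub> \<oplus>\<^bsub>?R\<^esub> x = x"
      using plus_zer[of x] plus_commute[of x zer] \<open>x \<in> carrier ?R\<close> by (simp add: simps)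
  qed (simp_all add: simps plus_assoc, simp add: plus_commute)
  show "monoid ?R"
    by (rule monoidI) (simp_all add: simps m_assoc)
qed (simp_all add: plus_distrib induced_ring_def induced_add_def plus_def[symmetric])

text \<open>Turns negation into left multiplication by a constant, so that negating a family is an
  instance of left distributivity.\<close>

lemma induced_uminus:
  assumes "x \<in> carrier M"
  shows "\<ominus>\<^bsub>induced_ring M S\<^esub> x = neg_one \<otimes> x"
proof -
  interpret R: ring "induced_ring M S" by (rule ring_induced)
  have "(neg_one \<otimes> x) \<oplus>\<^bsub>induced_ring M S\<^esub> x = \<zero>\<^bsub>induced_ring M S\<^esub>"
    using plus_neg_one_mult[OF assms] plus_commute[OF assms, of "neg_one \<otimes> x"] assms neg_one_closed
    by (simp add: induced_ring_def induced_add_def plus_def zer_def)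
  moreover have "x \<in> carrier (induced_ring M S)" "neg_one \<otimes> x \<in> carrier (induced_ring M S)"
    using assms neg_one_closed by (simp_all add: induced_ring_def)
  ultimately show ?thesis by (rule R.minus_equality)
qed

section \<open>Properties of the summation system\<close>

lemma induced_add_eq: "x \<in> carrier M \<Longrightarrow> y \<in> carrier M \<Longrightarrow> induced_add S x y = Some (x +\<^sub>S y)"
  by (simp add: induced_add_def pair_summable)

lemma S_eq_Some_sumval: "a \<in> dom S \<Longrightarrow> S a = Some (sumval S a)"
  by (auto simp: sumval_def)

lemma sums_to_dom: "a \<in> dom S \<Longrightarrow> sums_to (dom a) (\<lambda>i. the (a i)) (sumval S a)"
  by (simp add: sums_to_def S_eq_Some_sumval)

lemma sums_to_restrict: "J \<subseteq> dom a \<Longrightarrow> sums_to J (\<lambda>i. the (a i)) t \<longleftrightarrow> S (a |` J) = Some t"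
  by (simp add: sums_to_def restrict_eq_fam)

lemma reindexing: "reindexing_invariance S"
  unfolding reindexing_invariance_def
proof (intro ballI allI impI)
  fix a I' and \<phi> :: "'v \<Rightarrow> 'v"
  assume a: "a \<in> dom S" and \<phi>: "bij_betw \<phi> I' (dom a)"
  have "\<phi> i \<in> dom a" if "i \<in> I'" for i
    using bij_betwE[OF \<phi>] that by blast
  then have "(a \<circ> \<phi>) |` I' = fam I' (\<lambda>i. the (a (\<phi> i)))"
    by (auto simp: fam_def restrict_map_def fun_eq_iff domIff)
  moreover have "sums_to I' (\<lambda>i. the (a (\<phi> i))) (sumval S a)"
    by (rule sums_to_reindex[OF sums_to_dom[OF a] \<phi>])
  ultimately show "(a \<circ> \<phi>) |` I' \<in> dom S \<and> S ((a \<circ> \<phi>) |` I') = S a"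
    using a by (auto simp: sums_to_def sumval_def)
qed

lemma subfamilies: "subfamilies_summable S"
  unfolding subfamilies_summable_def
proof (intro ballI allI impI)
  fix a I' assume a: "a \<in> dom S" and I': "I' \<subseteq> dom a"
  obtain t where "sums_to I' (\<lambda>i. the (a i)) t"
    by (rule sums_to_subset[OF sums_to_dom[OF a] I'])
  then show "a |` I' \<in> dom S" using I' by (auto simp: sums_to_restrict)
qed

text \<open>A nonzero entry of \<open>b\<close> outside \<open>dom a\<close> would lie in the core
  of \<open>b\<close>, hence in that of \<open>a\<close>, which is impossible; so \<open>b\<close>
  extends \<open>a\<close> by zeros only.\<close>

lemma zero_nothing: "zero_means_nothing (carrier M) S"
  unfolding zero_means_nothing_def
proof (intro ballI impI)
  fix a b assume b: "b \<in> families (carrier M)" and ext: "core_extension S a b"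
  have le: "a \<subseteq>\<^sub>m b" and core: "core S a = core S b"
    using ext by (auto simp: core_extension_def)
  have dom: "dom a \<subseteq> dom b" using le by (rule map_le_implies_dom_le)
  have "the (b i) = zer" if "i \<in> dom b - dom a" for i
  proof (rule ccontr)
    assume "the (b i) \<noteq> zer"
    then have "core S b i = b i" using that by (auto simp: core_def S_empty restrict_map_def)
    then have "core S a i = b i" using core by simp
    then show False using that by (auto simp: core_def restrict_map_def split: if_splits)
  qed
  moreover have "small (dom b)" using b by (simp add: families_def)
  ultimately have "S b = Some s \<longleftrightarrow> sums_to (dom a) (\<lambda>i. the (b i)) s" for s
    using sums_to_zero_extension_iff[of "dom b" "dom a" "\<lambda>i. the (b i)" s] dom
    by (simp add: sums_to_def)
  moreover have "fam (dom a) (\<lambda>i. the (b i)) = a"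
    using le by (subst (2) fam_dom[of a, symmetric], intro fam_cong) (simp add: map_le_def)
  ultimately have "S b = Some s \<longleftrightarrow> S a = Some s" for s
    by (simp add: sums_to_def)
  then show "(b \<in> dom S \<longleftrightarrow> a \<in> dom S) \<and> (a \<in> dom S \<longrightarrow> S a = S b)"
    by (metis domD domI)
qed

lemma singletons: "singletons_sum_simply (carrier M) S"
  unfolding singletons_sum_simply_def
proof (intro allI ballI)
  fix i :: 'v and x assume "x \<in> carrier M"
  then have "sums_to {i} (\<lambda>_. x) x" by (rule sums_to_singleton)
  moreover have "fam {i} (\<lambda>_. x) = [i \<mapsto> x]" by (auto simp: fam_def)
  ultimately show "S [i \<mapsto> x] = Some x" by (simp add: sums_to_def)
qed

lemma extension_closure: "additive_extension_closure (carrier M) S"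
  unfolding additive_extension_closure_def
proof (intro ballI allI impI)
  fix a l x assume a: "a \<in> dom S" and l: "l \<notin> dom a" and x: "x \<in> carrier M"
  let ?f = "\<lambda>i. the ((a(l \<mapsto> x)) i)"
  have "sums_to (dom a) (\<lambda>i. the (a i)) (sumval S a)" using a by (rule sums_to_dom)
  then have s: "sums_to (dom a) ?f (sumval S a)"
    by (rule sums_to_cong) (use l in auto)
  then have "sumval S a \<in> carrier M" by (rule sums_to_closed)
  moreover have "sums_to (insert l (dom a)) ?f (sumval S a +\<^sub>S ?f l)"
    by (rule sums_to_insert[OF s l]) (simp add: x)
  moreover have "fam (insert l (dom a)) ?f = a(l \<mapsto> x)"
    using fam_dom[of "a(l \<mapsto> x)"] by simp
  ultimately show "a(l \<mapsto> x) \<in> dom S \<and> S (a(l \<mapsto> x)) = induced_add S (sumval S a) x"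
    using x by (auto simp: sums_to_def induced_add_eq)
qed

lemma finite_total: "finite_totality (carrier M) S"
proof -
  have "\<exists>t. sums_to I f t" if "finite I" "f \<in> I \<rightarrow> carrier M" for I f
    using that
  proof (induction I)
    case empty
    show ?case using sums_to_empty by blast
  next
    case (insert l I)
    then show ?case using sums_to_insert[of I f _ l] by auto
  qed
  then show ?thesis
    unfolding finite_totality_def
    by (metis domI fam_dom fam_in_families sums_to_def)
qed

lemma merger: "monoid_merger S"
  unfolding monoid_merger_def
proof (intro ballI allI impI)
  fix a K and \<psi> :: "'v \<Rightarrow> 'v set"
  assume a: "a \<in> dom S" and K: "small K" and \<psi>: "\<psi> \<in> K \<rightarrow> Pow (dom a)"
    and ex1: "\<forall>i \<in> dom a. \<exists>!k. k \<in> K \<and> i \<in> \<psi> k"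
  from a have s: "S a = Some (sumval S a)" "sums_to (dom a) (\<lambda>i. the (a i)) (sumval S a)"
    by (rule S_eq_Some_sumval, rule sums_to_dom)
  obtain A where A: "\<And>k. k \<in> K \<Longrightarrow> sums_to (\<psi> k) (\<lambda>i. the (a i)) (A k)" "sums_to K A (sumval S a)"
    by (rule sums_to_merge[OF s(2) K, of \<psi>]) (use \<psi> ex1 in auto)
  have *: "S (a |` \<psi> k) = Some (A k)" if "k \<in> K" for k
    using A(1)[OF that] \<psi> that by (subst (asm) sums_to_restrict) auto
  have "sums_to K (\<lambda>k. sumval S (a |` \<psi> k)) (sumval S a)"
    using A(2) by (rule sums_to_cong) (simp add: * sumval_def)
  with * s(1) show "(\<forall>k\<in>K. a |` \<psi> k \<in> dom S) \<and> S a = S (fam K (\<lambda>k. sumval S (a |` \<psi> k)))"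
    by (auto simp: sums_to_def)
qed

lemma dom_small: "a \<in> dom S \<Longrightarrow> small (dom a)"
  by (rule sums_to_small[OF sums_to_dom])

text \<open>Blocks are sets of indices, not indices; coded by \<open>vset\<close> and decoded by
  \<open>elts\<close>, they become an instance of monoid merger with \<open>\<psi>\<close> equal to
  \<open>elts\<close>.\<close>

lemma insertive: "insertive_associativity S"
  unfolding insertive_associativity_def
proof (intro ballI allI impI)
  fix a P assume a: "a \<in> dom S" and P: "partition_on (dom a) P"
  have small: "small J" if "J \<in> P" for J
  proof (rule small_subset[OF dom_small[OF a]])
    show "J \<subseteq> dom a" using P that unfolding partition_on_def by blast
  qed
  then have inj: "inj_on vset P" by (auto simp: inj_on_def vset_inject)
  have block: "\<exists>!J. J \<in> P \<and> i \<in> J" if "i \<in> dom a" for i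
    using P that unfolding partition_on_def disjoint_def by blast
  \<comment> \<open>Smallness of the set of codes: blocks are nonempty, so each code is the image of
    one of its indices under the map from an index to the code of its block.\<close>
  have "vset ` P \<subseteq> (\<lambda>i. vset (THE J. J \<in> P \<and> i \<in> J)) ` dom a"
  proof (rule image_subsetI)
    fix J assume J: "J \<in> P"
    then have "J \<noteq> {}" using partition_onD3[OF P] by blast
    then obtain i where i: "i \<in> J" "i \<in> dom a"
      using partition_onD1[OF P] J by blast
    then have "(THE J. J \<in> P \<and> i \<in> J) = J"
      using block J by (intro the1_equality) auto
    with i show "vset J \<in> (\<lambda>i. vset (THE J. J \<in> P \<and> i \<in> J)) ` dom a" by blast
  qed
  then have K: "small (vset ` P)"
    by (rule small_subset[OF small_image[OF dom_small[OF a]]])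
  have sub: "elts \<in> vset ` P \<rightarrow> Pow (dom a)"
    using P small by (auto simp: elts_vset partition_on_def)
  have "\<forall>i\<in>dom a. \<exists>!k. k \<in> vset ` P \<and> i \<in> elts k"
  proof
    fix i assume "i \<in> dom a"
    then obtain J where J: "J \<in> P" "i \<in> J" "\<And>J'. J' \<in> P \<Longrightarrow> i \<in> J' \<Longrightarrow> J' = J"
      using block by blast
    show "\<exists>!k. k \<in> vset ` P \<and> i \<in> elts k"
    proof (rule ex1I[of _ "vset J"])
      show "vset J \<in> vset ` P \<and> i \<in> elts (vset J)"
        using J(1,2) by (simp add: elts_vset small)
      fix k assume k: "k \<in> vset ` P \<and> i \<in> elts k"
      then obtain J' where J': "J' \<in> P" "k = vset J'" by blast
      then have "i \<in> J'" using k by (simp add: elts_vset small)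
      with J(3) J' show "k = vset J" by simp
    qed
  qed
  with merger a K sub have *: "\<forall>k\<in>vset ` P. a |` elts k \<in> dom S"
      "S a = S (fam (vset ` P) (\<lambda>k. sumval S (a |` elts k)))"
    unfolding monoid_merger_def by blast+
  have "fam_by vset P (\<lambda>J. sumval S (a |` J)) = fam (vset ` P) (\<lambda>k. sumval S (a |` elts k))"
    unfolding fam_by_def
    by (rule fam_cong) (auto simp: inv_into_f_f[OF inj] elts_vset small)
  with * show "(\<forall>J\<in>P. a |` J \<in> dom S) \<and> S a = S (fam_by vset P (\<lambda>J. sumval S (a |` J)))"
    by (auto simp: elts_vset small)
qed

lemma seq_eq_fam: "seq f = fam (range vnat) (\<lambda>k. f (inv_into UNIV vnat k))"
  by (simp add: seq_def fam_by_def)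

lemma prefix: "prefix_associativity S"
  unfolding prefix_associativity_def
proof (intro allI impI)
  fix f :: "nat \<Rightarrow> 'a" assume f: "seq f \<in> dom S"
  let ?N = "range vnat :: 'v set" and ?g = "\<lambda>k :: 'v. f (inv_into UNIV vnat k)"
  \<comment> \<open>The successor on codes: the tail is the subfamily over its range, pulled back
    along it to all codes.\<close>
  let ?suc = "\<lambda>k :: 'v. vnat (Suc (inv_into UNIV vnat k)) :: 'v"
  have inv [simp]: "inv_into UNIV vnat (vnat n :: 'v) = n" for n
    by (rule inv_f_f[OF inj_vnat])
  obtain s where s: "sums_to ?N ?g s"
    using f by (auto simp: seq_eq_fam sums_to_def)
  obtain t where t: "sums_to (?suc ` ?N) ?g t"
    by (rule sums_to_subset[OF s, of "?suc ` ?N"]) auto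
  have "inj_on ?suc ?N" by (auto simp: inj_on_def)
  then have tail: "sums_to ?N (\<lambda>k. ?g (?suc k)) t"
    using t by (simp add: sums_to_image_iff)
  have "k \<in> ?N \<longleftrightarrow> k = vnat 0 \<or> k \<in> ?suc ` ?N" for k
  proof
    assume "k \<in> ?N"
    then obtain n where k: "k = vnat n" by blast
    show "k = vnat 0 \<or> k \<in> ?suc ` ?N"
    proof (cases n)
      case (Suc m)
      then have "k = ?suc (vnat m)" by (simp only: k inv)
      then show ?thesis by blast
    qed (simp add: k)
  qed auto
  then have N: "?N = insert (vnat 0) (?suc ` ?N)" by blast
  have f0: "f 0 \<in> carrier M" using sums_to_mem[OF s] inv[of 0] by force
  have "vnat 0 \<notin> ?suc ` ?N" by auto
  then have "sums_to ?N ?g (t +\<^sub>S ?g (vnat 0))"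
    by (subst N, intro sums_to_insert t) (use f0 in \<open>simp_all only: inv\<close>)
  with s have "s = t +\<^sub>S f 0"
    by (simp only: inv) (rule sums_to_unique)
  \<comment> \<open>Insertion puts the new entry on the right, whereas a prefix stands on the
    left.\<close>
  then have "s = f 0 +\<^sub>S t" using plus_commute[OF f0 sums_to_closed[OF t]] by simp
  moreover have "S (seq (\<lambda>i. f (Suc i))) = Some t"
    using tail by (simp only: inv seq_eq_fam sums_to_def)
  moreover have "S (seq f) = Some s" using s by (simp add: seq_eq_fam sums_to_def)
  ultimately show "seq (\<lambda>i. f (Suc i)) \<in> dom S \<and>
      S (seq f) = induced_add S (f 0) (sumval S (seq (\<lambda>i. f (Suc i))))"
    using f0 sums_to_closed[OF t] by (auto simp: sumval_def induced_add_eq)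
qed

lemma addition_functorial: "addition_functoriality S"
  unfolding addition_functoriality_def
proof (intro ballI)
  fix a b assume a: "a \<in> dom S" and b: "b \<in> dom S"
  let ?L = "dom a \<union> dom b"
  have L: "small ?L" using a b by (intro small_Un dom_small)
  \<comment> \<open>Extending both families by zeros to the common index set reduces the claim to
    the componentwise sum over one index set.\<close>
  have ext: "sums_to L (entry0 S c) (sumval S c)"
    if "c \<in> dom S" "dom c \<subseteq> L" "small L" for c L
  proof (rule sums_to_zero_extension)
    have "sums_to (dom c) (\<lambda>i. the (c i)) (sumval S c)" using that(1) by (rule sums_to_dom)
    then show "sums_to (dom c) (entry0 S c) (sumval S c)"
      by (rule sums_to_cong) (auto simp: entry0_def)
    show "entry0 S c i = zer" if "i \<in> L - dom c" for i
      using that by (auto simp: entry0_def zer_def split: option.splits)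
  qed (use that in auto)
  have sa: "sums_to ?L (entry0 S a) (sumval S a)" and sb: "sums_to ?L (entry0 S b) (sumval S b)"
    using a b L by (auto intro!: ext)
  have "fam_add S a b = fam ?L (\<lambda>i. entry0 S a i +\<^sub>S entry0 S b i)"
    using sums_to_mem[OF sa] sums_to_mem[OF sb]
    by (auto simp: fam_add_def fam_def fun_eq_iff induced_add_eq Pi_iff)
  then show "dom (fam_add S a b) = ?L \<and> fam_add S a b \<in> dom S \<and>
      S (fam_add S a b) = induced_add S (sumval S a) (sumval S b)"
    using sums_to_plus[OF sa sb] sums_to_closed[OF sa] sums_to_closed[OF sb]
    by (auto simp: sums_to_def induced_add_eq)
qed

lemma negation_functorial: "negation_functoriality M S"
  unfolding negation_functoriality_def
proof
  fix a assume "a \<in> dom S"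
  then have a: "sums_to (dom a) (\<lambda>i. the (a i)) (sumval S a)" by (rule sums_to_dom)
  have "the (a i) \<in> carrier M" if "i \<in> dom a" for i
    using sums_to_mem[OF a] that by auto
  then have "map_option (\<lambda>x. \<ominus>\<^bsub>induced_ring M S\<^esub> x) \<circ> a = fam (dom a) (\<lambda>i. neg_one \<otimes> the (a i))"
    by (force simp: fam_def fun_eq_iff induced_uminus domIff)
  then show "S (map_option (\<lambda>x. \<ominus>\<^bsub>induced_ring M S\<^esub> x) \<circ> a) = Some (\<ominus>\<^bsub>induced_ring M S\<^esub> sumval S a)"
    using sums_to_distrib_left[OF a neg_one_closed] sums_to_closed[OF a]
    by (simp add: sums_to_def induced_uminus)
qed

text \<open>The family is its restriction to \<open>dom a - {m}\<close> extended at
  \<open>m\<close>, so additive extension closure applies.\<close>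

lemma postfix: "postfix_associativity S"
  unfolding postfix_associativity_def
proof (intro ballI impI)
  fix a m assume a: "a \<in> dom S" and m: "m \<in> dom a"
  let ?a = "a |` (dom a - {m})"
  have sub: "?a \<in> dom S" using subfamilies a by (auto simp: subfamilies_summable_def)
  have "the (a m) \<in> carrier M"
    by (rule funcset_mem[OF sums_to_mem[OF sums_to_dom[OF a]] m])
  moreover have "m \<notin> dom ?a" by simp
  ultimately have "S (?a(m \<mapsto> the (a m))) = induced_add S (sumval S ?a) (the (a m))"
    using extension_closure sub unfolding additive_extension_closure_def by blast
  moreover have "?a(m \<mapsto> the (a m)) = a"
    using m by (auto simp: fun_eq_iff restrict_map_def)
  ultimately show "?a \<in> dom S \<and> S a = induced_add S (sumval S ?a) (the (a m))"
    using sub by simp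
qed

lemma ordinal_insertive: "ordinal_insertive_associativity S"
  unfolding ordinal_insertive_associativity_def
proof (intro ballI allI impI)
  fix a K and J :: "'v \<Rightarrow> 'v set"
  assume a: "a \<in> dom S" and disj: "disjoint_family_on J K" and Un: "(\<Union>k\<in>K. J k) = dom a"
    and k: "\<forall>k\<in>K. ord_subinterval (J k) (dom a) \<and> k \<in> J k"
  \<comment> \<open>Each \<open>k\<close> lies in its own block, which makes the transversal a set
    of indices and therefore small, as monoid merger requires.\<close>
  have "K \<subseteq> dom a" using Un k by blast
  then have "small K" by (rule small_subset[OF dom_small[OF a]])
  moreover have "J \<in> K \<rightarrow> Pow (dom a)" using Un by auto
  moreover have "\<forall>i\<in>dom a. \<exists>!k. k \<in> K \<and> i \<in> J k"
  proof
    fix i assume "i \<in> dom a"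
    then obtain k where "k \<in> K" "i \<in> J k" using Un by blast
    then show "\<exists>!k. k \<in> K \<and> i \<in> J k"
      using disj unfolding disjoint_family_on_def by (intro ex1I[of _ k]) blast+
  qed
  ultimately show "(\<forall>k\<in>K. a |` J k \<in> dom S) \<and> S a = S (fam K (\<lambda>k. sumval S (a |` J k)))"
    using merger a unfolding monoid_merger_def by blast
qed

lemma distributivity: "infinite_distributivity M S"
  unfolding infinite_distributivity_def
proof (intro ballI)
  fix a b assume "a \<in> dom S" and "b \<in> dom S"
  then have a: "sums_to (dom a) (\<lambda>i. the (a i)) (sumval S a)"
    and b: "sums_to (dom b) (\<lambda>i. the (b i)) (sumval S b)"
    by (simp_all only: sums_to_dom)
  have inj: "inj_on (\<lambda>(i, j). vpair i j :: 'v) (dom a \<times> dom b)" by (auto simp: inj_on_def)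
  have "sums_to ((\<lambda>(i, j). vpair i j) ` (dom a \<times> dom b))
      (\<lambda>k. case inv_into (dom a \<times> dom b) (\<lambda>(i, j). vpair i j) k of
         (i, j) \<Rightarrow> the (a i) \<otimes> the (b j)) (sumval S a \<otimes> sumval S b)"
  proof (rule sums_to_product[OF a b])
    fix i j assume "i \<in> dom a" "j \<in> dom b"
    then have "inv_into (dom a \<times> dom b) (\<lambda>(i, j). vpair i j) (vpair i j) = (i, j)"
      using inv_into_f_f[OF inj, of "(i, j)"] by simp
    then show "(case inv_into (dom a \<times> dom b) (\<lambda>(i, j). vpair i j) (vpair i j) of
        (i, j) \<Rightarrow> the (a i) \<otimes> the (b j)) = the (a i) \<otimes> the (b j)"
      by simp
  qed
  then show "S (fam_by (\<lambda>(i, j). vpair i j) (dom a \<times> dom b) (\<lambda>(i, j). the (a i) \<otimes> the (b j)))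
      = Some (sumval S a \<otimes> sumval S b)"
    by (simp add: fam_by_def sums_to_def)
qed

lemma left_multiple: "left_multiple_summability M S"
  unfolding left_multiple_summability_def
proof (intro ballI)
  fix a r assume "a \<in> dom S" "r \<in> dom a \<rightarrow> carrier M"
  then obtain t where "sums_to (dom a) (\<lambda>i. r i \<otimes> the (a i)) t"
    by (rule sums_to_left_multiple[OF sums_to_dom])
  then show "fam (dom a) (\<lambda>i. r i \<otimes> the (a i)) \<in> dom S"
    by (auto simp: sums_to_def)
qed

end


theorem theorem10p5:
  fixes M :: "('x, 'm) monoid_scheme"
    and S :: "('v::set_universe, 'x) summation"
  assumes "monoid M"
    and "summation_system (carrier M) S"
    and "left_reorderability M S"
    and "ran S = carrier M"
    and "\<And>i. S [i \<mapsto> \<one>\<^bsub>M\<^esub>] = Some \<one>\<^bsub>M\<^esub>"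
    and "\<exists>m \<in> carrier M. Map.empty \<in> dom S \<and> pair_fam \<one>\<^bsub>M\<^esub> m \<in> dom S \<and>
           S (pair_fam \<one>\<^bsub>M\<^esub> m) = S Map.empty"
  shows "reindexing_invariance S \<and>
         subfamilies_summable S \<and>
         empty_sum_existence S \<and>
         zero_means_nothing (carrier M) S \<and>
         singletons_sum_simply (carrier M) S \<and>
         finite_totality (carrier M) S \<and>
         prefix_associativity S \<and>
         insertive_associativity S \<and>
         monoid_merger S \<and>
         additive_extension_closure (carrier M) S \<and>
         addition_functoriality S \<and>
         negation_functoriality M S \<and>
         ordinal_reindexing_invariance S \<and>
         initial_summability S \<and>
         postfix_associativity S \<and>
         ordinal_insertive_associativity S \<and>
         infinite_distributivity M S \<and>
         left_multiple_summability M S \<and>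
         left_reorderability M S \<and>
         ring (induced_ring M S)"
proof -
  obtain m where m: "m \<in> carrier M" "Map.empty \<in> dom S" "S (pair_fam \<one>\<^bsub>M\<^esub> m) = S Map.empty"
    using assms(6) by blast
  interpret monoid M by (rule assms(1))
  interpret left_reorderable_summation M S m
    by unfold_locales (use assms m in auto)
  have "empty_sum_existence S"
    using m(2) by (simp add: empty_sum_existence_def)
  moreover have "ordinal_reindexing_invariance S"
    using reindexing
    by (simp add: reindexing_invariance_def ordinal_reindexing_invariance_def ord_iso_def)
  moreover have "initial_summability S"
    using subfamilies by (simp add: subfamilies_summable_def initial_summability_def)
  ultimately show ?thesis
    using reindexing subfamilies zero_nothing singletons finite_total prefix insertive merger
      extension_closure addition_functorial negation_functorial postfix ordinal_insertive
      distributivity left_multiple assms(3) ring_induced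
    by blast
qed

end
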